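(* Let $G$ be a minimally 2-connected graph with $m$ edges. (i) If $m$ is even, then $\rho(G)\le \sqrt{m}$, with equality if and only if $G\cong K_{2,m/2}$. (ii) If $m$ is odd and $m\ge 9$, then $\rho(G)\le \rho_1^*(m)$, where $\rho_1^*(m)$ is the largest root of $x^3-x^2-(m-2)x+m-3=0$, with equality if and only if $G\cong SK_{2,\frac{m-1}{2}}$.
   Context: All graphs are finite and simple. The size of a graph is its number of edges. $\rho(G)$ denotes the spectral radius of $G$, i.e. the largest eigenvalue of its adjacency matrix. A graph is minimally 2-connected if it is 2-connected but deleting any one edge leaves a graph that is not 2-connected. $K_{a,b}$ is the complete bipartite graph. For odd $m$, $SK_{2,\frac{m-1}{2}}$ denotes the graph obtained from $K_{2,\frac{m-1}{2}}$ by subdividing one edge once (replacing one edge $xy$ by a path $xzy$ through a new vertex $z$); it has $m$ edges. *)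

theory Defs
  imports Complex_Main
begin

definition simple_graph :: "'a set \<Rightarrow> 'a set set \<Rightarrow> bool" where
  "simple_graph V E \<longleftrightarrow> finite V \<and>
     (\<forall>e\<in>E. \<exists>u v. e = {u, v} \<and> u \<in> V \<and> v \<in> V \<and> u \<noteq> v)"

definition connected_graph :: "'a set \<Rightarrow> 'a set set \<Rightarrow> bool" where
  "connected_graph V E \<longleftrightarrow> V \<noteq> {} \<and>
     (\<forall>u\<in>V. \<forall>v\<in>V. (\<lambda>x y. {x, y} \<in> E)\<^sup>*\<^sup>* u v)"

definition del_vertex_E :: "'a set set \<Rightarrow> 'a \<Rightarrow> 'a set set" where
  "del_vertex_E E v = {e \<in> E. v \<notin> e}"

definition two_connected :: "'a set \<Rightarrow> 'a set set \<Rightarrow> bool" where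
  "two_connected V E \<longleftrightarrow> card V \<ge> 3 \<and> connected_graph V E \<and>
     (\<forall>v\<in>V. connected_graph (V - {v}) (del_vertex_E E v))"

definition minimally_2_connected :: "'a set \<Rightarrow> 'a set set \<Rightarrow> bool" where
  "minimally_2_connected V E \<longleftrightarrow> two_connected V E \<and>
     (\<forall>e\<in>E. \<not> two_connected V (E - {e}))"

text \<open>Eigenvalues of the adjacency matrix A (indexed by V): lambda with A x = lambda x
  for a nonzero vector x in R^V.  A is real symmetric, so all its eigenvalues are real.\<close>
definition adj_eigenvalues :: "'a set \<Rightarrow> 'a set set \<Rightarrow> real set" where
  "adj_eigenvalues V E = {\<mu>. \<exists>x :: 'a \<Rightarrow> real. (\<exists>u\<in>V. x u \<noteq> 0) \<and>
     (\<forall>u\<in>V. (\<Sum>w\<in>V. (if {u, w} \<in> E then 1 else 0) * x w) = \<mu> * x u)}"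

definition spectral_radius :: "'a set \<Rightarrow> 'a set set \<Rightarrow> real" where
  "spectral_radius V E = Max (adj_eigenvalues V E)"

definition graph_iso :: "'a set \<Rightarrow> 'a set set \<Rightarrow> 'b set \<Rightarrow> 'b set set \<Rightarrow> bool" where
  "graph_iso V E V' E' \<longleftrightarrow> (\<exists>f. bij_betw f V V' \<and>
     (\<forall>u\<in>V. \<forall>v\<in>V. {u, v} \<in> E \<longleftrightarrow> {f u, f v} \<in> E'))"

definition K2_V :: "nat \<Rightarrow> nat set" where
  "K2_V k = {0..k+1}"

definition K2_E :: "nat \<Rightarrow> nat set set" where
  "K2_E k = {{i, j} | i j. i \<in> {0, 1} \<and> j \<in> {2..k+1}}"

text \<open>SK_{2,k}: K_{2,k} with the edge {0,2} subdivided by the new vertex k+2.\<close>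
definition SK2_V :: "nat \<Rightarrow> nat set" where
  "SK2_V k = {0..k+2}"

definition SK2_E :: "nat \<Rightarrow> nat set set" where
  "SK2_E k = (K2_E k - {{0, 2}}) \<union> {{0, k+2}, {k+2, 2}}"

definition rho1_star :: "nat \<Rightarrow> real" where
  "rho1_star m = Max {x :: real. x ^ 3 - x ^ 2 - (real m - 2) * x + real m - 3 = 0}"

end

(* Take an eigenvector of the eigenvalue l with largest entry x u = 1 in absolute value and let N
   be the neighbourhood of u. Minimality forbids chords of cycles, so N is independent (unless the
   graph is a triangle), and expanding l^2 = l^2 * x u over walks of length two bounds l^2 by the
   degree sum over N, i.e. by m minus the number of edges that do not meet N.

   Without such an edge, chordlessness forces K_{2,k}, and m is even. With at least two of them,
   l^2 <= m - 2, which makes the cubic negative at l. With exactly one such edge w1 w2 (and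
   card N >= 3, as otherwise l <= 2), chordlessness leaves only u, w1, w2 together with a common
   neighbours of u and w1 and b common neighbours of u and w2, where m = 2 a + 2 b + 1. The
   eigenvalue equations then yield
     cubic(l) * (l^2 + l - 1) + (a - 1) * (b - 1) * (3 * l - 2) = 0,
   so cubic(l) <= 0, with equality only if a = 1 or b = 1, i.e. for SK_{2,(m-1)/2}. *)
theory Submission
  imports "Jordan_Normal_Form.Char_Poly" "HOL-Computational_Algebra.Fundamental_Theorem_Algebra" Defs
begin

section \<open>Eigenvalues of the adjacency matrix\<close>

text \<open>The bridge from functions on \<open>V\<close> to matrices with indices
  \<open>0..<n\<close>, along an enumeration \<open>h\<close>. The field is arbitrary because both
  real and complex entries occur below.\<close>

lemma eigenvalue_indexed_mat_iff:
  fixes M :: "'a \<Rightarrow> 'a \<Rightarrow> 'b::field"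
  assumes h: "bij_betw h {0..<n} V"
  shows "eigenvalue (mat n n (\<lambda>(i, j). M (h i) (h j))) k \<longleftrightarrow>
    (\<exists>z. (\<exists>u\<in>V. z u \<noteq> 0) \<and> (\<forall>u\<in>V. (\<Sum>w\<in>V. M u w * z w) = k * z u))"
    (is "eigenvalue ?A k \<longleftrightarrow> ?R")
proof
  have sum_h: "(\<Sum>w\<in>V. M u w * z w) = (\<Sum>j = 0..<n. M u (h j) * z (h j))" for u z
    by (rule sum.reindex_bij_betw[OF h, symmetric])
  have mult_index: "(?A *\<^sub>v v) $ i = (\<Sum>j = 0..<n. M (h i) (h j) * v $ j)"
    if "i < n" "dim_vec v = n" for v :: "'b vec" and i
    using that by (simp add: mult_mat_vec_def scalar_prod_def)
  have h_mem: "h i \<in> V" if "i < n" for i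
    using h that by (auto simp: bij_betw_def)
  have h_surj: "\<exists>i<n. u = h i" if "u \<in> V" for u
    using h that by (auto simp: bij_betw_def)
  {
    assume "eigenvalue ?A k"
    then obtain v where "eigenvector ?A v k" by (auto simp: eigenvalue_def)
    then have v: "dim_vec v = n" "v \<noteq> 0\<^sub>v n" "?A *\<^sub>v v = k \<cdot>\<^sub>v v"
      by (simp_all add: eigenvector_def)
    define z where "z u = v $ inv_into {0..<n} h u" for u
    have z_h: "z (h i) = v $ i" if "i < n" for i
      using h that by (simp add: z_def bij_betw_def inv_into_f_f)
    obtain i where i: "i < n" "v $ i \<noteq> 0"
      using v by (metis eq_vecI index_zero_vec)
    have "(\<Sum>w\<in>V. M u w * z w) = k * z u" if u: "u \<in> V" for u
    proof -
      obtain i where i: "i < n" "u = h i" using h_surj[OF u] by blast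
      have "(\<Sum>w\<in>V. M u w * z w) = (\<Sum>j = 0..<n. M (h i) (h j) * v $ j)"
        unfolding sum_h i by (intro sum.cong) (auto simp: z_h)
      also have "\<dots> = (k \<cdot>\<^sub>v v) $ i"
        using mult_index[OF i(1) v(1)] v(3) by simp
      also have "\<dots> = k * z u" using i v by (simp add: z_h)
      finally show ?thesis .
    qed
    moreover have "\<exists>u\<in>V. z u \<noteq> 0"
      using i z_h h_mem by metis
    ultimately show ?R by blast
  }
  assume ?R
  then obtain z u where u: "u \<in> V" "z u \<noteq> 0"
    and z: "\<And>u. u \<in> V \<Longrightarrow> (\<Sum>w\<in>V. M u w * z w) = k * z u" by blast
  define v where "v = vec n (\<lambda>i. z (h i))"
  obtain i where i: "i < n" "u = h i" using h_surj[OF u(1)] by blast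
  have "v \<noteq> 0\<^sub>v n"
  proof
    assume "v = 0\<^sub>v n"
    then have "v $ i = 0" using i by simp
    then show False using i u by (simp add: v_def)
  qed
  moreover have "?A *\<^sub>v v = k \<cdot>\<^sub>v v"
  proof (rule eq_vecI)
    fix i assume "i < dim_vec (k \<cdot>\<^sub>v v)"
    then have i: "i < n" by (simp add: v_def)
    have "(?A *\<^sub>v v) $ i = (\<Sum>j = 0..<n. M (h i) (h j) * v $ j)"
      using mult_index[OF i] by (simp add: v_def)
    also have "\<dots> = (\<Sum>w\<in>V. M (h i) w * z w)"
      unfolding sum_h by (intro sum.cong) (auto simp: v_def)
    also have "\<dots> = (k \<cdot>\<^sub>v v) $ i"
      using z[OF h_mem[OF i]] i by (simp add: v_def)
    finally show "(?A *\<^sub>v v) $ i = (k \<cdot>\<^sub>v v) $ i" .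
  qed (simp add: v_def)
  ultimately show "eigenvalue ?A k"
    by (auto simp: eigenvalue_def eigenvector_def v_def intro!: exI[of _ v])
qed

lemma finite_adj_eigenvalues:
  assumes "finite V"
  shows "finite (adj_eigenvalues V E)"
proof -
  define n where "n = card V"
  obtain h where h: "bij_betw h {0..<n} V"
    using ex_bij_betw_nat_finite[OF assms] n_def by blast
  define A where "A = mat n n (\<lambda>(i, j). if {h i, h j} \<in> E then 1 else 0 :: real)"
  have A: "A \<in> carrier_mat n n" by (simp add: A_def)
  have "adj_eigenvalues V E = {k. eigenvalue A k}"
    unfolding A_def adj_eigenvalues_def
    using eigenvalue_indexed_mat_iff[OF h, of "\<lambda>u w. if {u, w} \<in> E then 1 else 0 :: real"]
    by simp
  also have "\<dots> = {k. poly (char_poly A) k = 0}"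
    using eigenvalue_root_char_poly[OF A] by simp
  finally have roots: "adj_eigenvalues V E = {k. poly (char_poly A) k = 0}" .
  have "char_poly A \<noteq> 0"
    using degree_monic_char_poly[OF A] by auto
  then show ?thesis unfolding roots by (rule poly_roots_finite)
qed

text \<open>The characteristic polynomial has a complex root \<open>k\<close>. Symmetry of the
  adjacency matrix makes \<open>k\<close> real, and then the real or the imaginary part of a complex
  eigenvector is a real eigenvector.\<close>

lemma adj_eigenvalues_nonempty:
  assumes "finite V" "V \<noteq> {}"
  shows "adj_eigenvalues V E \<noteq> {}"
proof -
  define n where "n = card V"
  have n: "n > 0" using assms by (simp add: n_def card_gt_0_iff)
  obtain h where h: "bij_betw h {0..<n} V"
    using ex_bij_betw_nat_finite[OF assms(1)] n_def by blast
  define M where "M u w = (if {u, w} \<in> E then 1 else 0 :: real)" for u w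
  define A where "A = mat n n (\<lambda>(i, j). complex_of_real (M (h i) (h j)))"
  have A: "A \<in> carrier_mat n n" by (simp add: A_def)
  have "\<not> constant (poly (char_poly A))"
    using degree_monic_char_poly[OF A] n by (simp add: constant_degree)
  then obtain k where "poly (char_poly A) k = 0"
    using fundamental_theorem_of_algebra by blast
  then have "eigenvalue A k" by (simp only: eigenvalue_root_char_poly[OF A])
  then have "\<exists>z. (\<exists>u\<in>V. z u \<noteq> 0) \<and>
      (\<forall>u\<in>V. (\<Sum>w\<in>V. complex_of_real (M u w) * z w) = k * z u)"
    unfolding A_def by (rule eigenvalue_indexed_mat_iff[OF h, THEN iffD1])
  then obtain z where nz: "\<exists>u\<in>V. z u \<noteq> 0"
    and z: "\<And>u. u \<in> V \<Longrightarrow> (\<Sum>w\<in>V. complex_of_real (M u w) * z w) = k * z u"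
    by blast
  define S where "S = (\<Sum>u\<in>V. (cmod (z u))\<^sup>2)"
  have "S > 0"
    unfolding S_def using nz assms(1) by (auto intro!: sum_pos2)
  have M_sym: "M u w = M w u" for u w
    by (simp add: M_def insert_commute)
  \<comment> \<open>The Hermitian form of \<open>M\<close> at \<open>z\<close>. It equals
    \<open>k * S\<close> by the eigenvalue equations and is its own conjugate by symmetry of
    \<open>M\<close>; as \<open>S > 0\<close>, \<open>k\<close> is real.\<close>
  define K where "K = (\<Sum>u\<in>V. \<Sum>w\<in>V. complex_of_real (M u w) * (cnj (z u) * z w))"
  have "K = (\<Sum>u\<in>V. cnj (z u) * (\<Sum>w\<in>V. complex_of_real (M u w) * z w))"
    by (simp add: K_def sum_distrib_left mult_ac)
  also have "\<dots> = (\<Sum>u\<in>V. k * complex_of_real ((cmod (z u))\<^sup>2))"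
  proof (rule sum.cong)
    fix u assume "u \<in> V"
    show "cnj (z u) * (\<Sum>w\<in>V. complex_of_real (M u w) * z w)
        = k * complex_of_real ((cmod (z u))\<^sup>2)"
      unfolding z[OF \<open>u \<in> V\<close>] complex_norm_square by (simp only: mult_ac)
  qed simp
  also have "\<dots> = k * complex_of_real S"
    by (simp add: S_def sum_distrib_left)
  finally have K: "K = k * complex_of_real S" .
  have "cnj K = (\<Sum>u\<in>V. \<Sum>w\<in>V. complex_of_real (M u w) * (z u * cnj (z w)))"
    by (simp add: K_def)
  also have "\<dots> = (\<Sum>w\<in>V. \<Sum>u\<in>V. complex_of_real (M u w) * (z u * cnj (z w)))"
    by (rule sum.swap)
  also have "\<dots> = K"
    unfolding K_def by (intro sum.cong refl) (simp add: M_sym mult.commute)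
  finally have "cnj k * complex_of_real S = k * complex_of_real S" unfolding K by simp
  then have "cnj k = k" using \<open>S > 0\<close> by simp
  then have Im_k: "Im k = 0" by (simp add: complex_eq_iff)
  have "Re k \<in> adj_eigenvalues V E"
    if "\<exists>u\<in>V. x u \<noteq> 0" "\<And>u. u \<in> V \<Longrightarrow> (\<Sum>w\<in>V. M u w * x w) = Re k * x u" for x
    using that unfolding adj_eigenvalues_def M_def by blast
  moreover have "(\<Sum>w\<in>V. M u w * Re (z w)) = Re k * Re (z u)" if "u \<in> V" for u
    using arg_cong[OF z[OF that], of Re] Im_k by simp
  moreover have "(\<Sum>w\<in>V. M u w * Im (z w)) = Re k * Im (z u)" if "u \<in> V" for u
    using arg_cong[OF z[OF that], of Im] Im_k by simp
  moreover have "(\<exists>u\<in>V. Re (z u) \<noteq> 0) \<or> (\<exists>u\<in>V. Im (z u) \<noteq> 0)"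
    using nz by (auto simp: complex_eq_iff)
  ultimately have "Re k \<in> adj_eigenvalues V E" by fast
  then show ?thesis by blast
qed

lemma sum_adjacency_row:
  assumes "finite V"
  shows "(\<Sum>w\<in>V. (if {u, w} \<in> E then 1 else 0) * x w) = (sum x {w \<in> V. {u, w} \<in> E} :: real)"
proof -
  have "(\<Sum>w\<in>V. (if {u, w} \<in> E then 1 else 0) * x w) = (\<Sum>w\<in>V. if {u, w} \<in> E then x w else 0)"
    by (intro sum.cong) auto
  then show ?thesis using assms by (simp add: sum.inter_filter)
qed

lemma adj_eigenvalues_iff:
  assumes "finite V"
  shows "l \<in> adj_eigenvalues V E \<longleftrightarrow>
    (\<exists>x. (\<exists>u\<in>V. x u \<noteq> 0) \<and> (\<forall>u\<in>V. sum x {w \<in> V. {u, w} \<in> E} = l * x u))"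
  unfolding adj_eigenvalues_def sum_adjacency_row[OF assms] by simp

text \<open>An eigenvector of the second graph pulls back along the isomorphism. This direction
  carries the known eigenvalues of the extremal graphs over to \<open>(V, E)\<close>.\<close>

lemma adj_eigenvalues_graph_iso:
  assumes "graph_iso V E V' E'"
  shows "adj_eigenvalues V' E' \<subseteq> adj_eigenvalues V E"
proof
  obtain f where f: "bij_betw f V V'"
    and adj: "\<And>u v. u \<in> V \<Longrightarrow> v \<in> V \<Longrightarrow> {u, v} \<in> E \<longleftrightarrow> {f u, f v} \<in> E'"
    using assms unfolding graph_iso_def by blast
  fix l assume "l \<in> adj_eigenvalues V' E'"
  then obtain x where nz: "\<exists>u\<in>V'. x u \<noteq> 0"
    and x: "\<And>u. u \<in> V' \<Longrightarrow> (\<Sum>w\<in>V'. (if {u, w} \<in> E' then 1 else 0) * x w) = l * x u"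
    unfolding adj_eigenvalues_def by blast
  have "(\<Sum>w\<in>V. (if {u, w} \<in> E then 1 else 0) * x (f w)) = l * x (f u)" if "u \<in> V" for u
  proof -
    have "(\<Sum>w\<in>V. (if {u, w} \<in> E then 1 else 0) * x (f w))
        = (\<Sum>w\<in>V. (if {f u, f w} \<in> E' then 1 else 0) * x (f w))"
      using adj that by (intro sum.cong) auto
    also have "\<dots> = (\<Sum>w\<in>V'. (if {f u, w} \<in> E' then 1 else 0) * x w)"
      by (rule sum.reindex_bij_betw[OF f])
    also have "\<dots> = l * x (f u)" using x bij_betwE[OF f] that by blast
    finally show ?thesis .
  qed
  moreover have "\<exists>u\<in>V. x (f u) \<noteq> 0" using nz f by (auto simp: bij_betw_def)
  ultimately show "l \<in> adj_eigenvalues V E"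
    unfolding adj_eigenvalues_def by (intro CollectI exI[of _ "\<lambda>w. x (f w)"]) simp
qed

section \<open>The extremal graphs\<close>

lemma mem_K2_E: "{a, b} \<in> K2_E k \<longleftrightarrow>
    a \<in> {0, 1} \<and> b \<in> {2..k+1} \<or> b \<in> {0, 1} \<and> a \<in> {2..k+1}"
  unfolding K2_E_def by (auto simp: doubleton_eq_iff)

lemma mem_SK2_E:
  fixes k :: nat
  assumes "k \<ge> 1"
  defines "P \<equiv> \<lambda>a b. (a = 0 \<or> a = 1) \<and> b \<in> {3..<k+2}
    \<or> a = 0 \<and> b = k + 2 \<or> a = k + 2 \<and> b = 2 \<or> a = 2 \<and> b = 1"
  shows "{a, b} \<in> SK2_E k \<longleftrightarrow> P a b \<or> P b a"
proof -
  have "b \<in> {2..k+1} \<longleftrightarrow> b = 2 \<or> b \<in> {3..<k+2}" for b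
    using assms(1) by auto
  then have "{a, b} \<in> K2_E k - {{0, 2}} \<longleftrightarrow>
      (a = 0 \<or> a = 1) \<and> b \<in> {3..<k+2} \<or> a = 1 \<and> b = 2
      \<or> (b = 0 \<or> b = 1) \<and> a \<in> {3..<k+2} \<or> b = 1 \<and> a = 2"
    unfolding Diff_iff mem_K2_E by (auto simp: doubleton_eq_iff)
  then show ?thesis
    unfolding SK2_E_def P_def Un_iff by (auto simp: doubleton_eq_iff)
qed

lemma finite_bij_betw_atLeastLessThan:
  assumes "finite M" "card M = j - i"
  obtains g where "bij_betw g M {i..<j::nat}"
  using assms finite_same_card_bij[of M "{i..<j}"] by auto

lemma graph_iso_K2I:
  assumes "finite M" "V = M \<union> {p, q}" "p \<noteq> q" "M \<inter> {p, q} = {}" "card M = k"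
    and adj: "\<And>x y. {x, y} \<in> E \<longleftrightarrow> x \<in> {p, q} \<and> y \<in> M \<or> y \<in> {p, q} \<and> x \<in> M"
  shows "graph_iso V E (K2_V k) (K2_E k)"
proof -
  obtain g where g: "bij_betw g M {2..<k + 2}"
    using finite_bij_betw_atLeastLessThan[of M "k + 2" 2] assms by auto
  define f where "f x = (if x = p then 0 else if x = q then 1 else g x)" for x
  have M: "bij_betw f M {2..<k + 2}"
  proof (rule bij_betw_cong[THEN iffD1, OF _ g])
    show "g x = f x" if "x \<in> M" for x using that assms(4) unfolding f_def by auto
  qed
  moreover have "bij_betw f {p, q} {0, 1}"
    using assms(3) unfolding bij_betw_def inj_on_def f_def by auto
  ultimately have "bij_betw f V ({2..<k + 2} \<union> {0, 1})"
    unfolding assms(2) by (rule bij_betw_combine) simp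
  moreover have "{2..<k + 2} \<union> {0, 1} = K2_V k"
    unfolding K2_V_def by auto
  moreover have "{u, v} \<in> E \<longleftrightarrow> {f u, f v} \<in> K2_E k" if "u \<in> V" "v \<in> V" for u v
  proof -
    have label: "(x \<in> {p, q} \<longleftrightarrow> f x \<in> {0, 1}) \<and> (x \<in> M \<longleftrightarrow> f x \<in> {2..k+1})" if "x \<in> V" for x
      using that assms(2-4) bij_betwE[OF M] unfolding f_def by fastforce
    show ?thesis
      unfolding adj mem_K2_E using label[OF that(1)] label[OF that(2)] by argo
  qed
  ultimately show ?thesis unfolding graph_iso_def by metis
qed

text \<open>In the labels of \<open>SK2_E\<close>, \<open>p\<close> and \<open>q\<close> are the
  hubs 0 and 1, \<open>c\<close> is the subdividing vertex \<open>k + 2\<close> and \<open>d\<close>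
  is the vertex 2. Thus \<open>p\<close>, \<open>c\<close>, \<open>d\<close>, \<open>q\<close> is a
  path and \<open>M\<close> consists of the common neighbours of the hubs.\<close>

lemma graph_iso_SK2I:
  assumes "finite M" "V = M \<union> {p, q, c, d}" "distinct [p, q, c, d]"
    "M \<inter> {p, q, c, d} = {}" "card M + 1 = k"
    and adj: "\<And>x y. {x, y} \<in> E \<longleftrightarrow> P x y \<or> P y x"
    and P: "\<And>x y. P x y \<longleftrightarrow> (x = p \<or> x = q) \<and> y \<in> M
      \<or> x = p \<and> y = c \<or> x = c \<and> y = d \<or> x = d \<and> y = q"
  shows "graph_iso V E (SK2_V k) (SK2_E k)"
proof -
  have "card M = k + 2 - 3" using assms(5) by simp
  then obtain g where g: "bij_betw g M {3..<k + 2}"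
    using finite_bij_betw_atLeastLessThan[OF assms(1)] by blast
  define f where "f x = (if x = p then 0 else if x = q then 1 else if x = d then 2
    else if x = c then k + 2 else g x)" for x
  have "k \<ge> 1" using assms(5) by simp
  have f: "f p = 0" "f q = 1" "f d = 2" "f c = k + 2"
    using assms(3) unfolding f_def by auto
  have M: "bij_betw f M {3..<k + 2}"
  proof (rule bij_betw_cong[THEN iffD1, OF _ g])
    show "g x = f x" if "x \<in> M" for x using that assms(4) unfolding f_def by auto
  qed
  moreover have "bij_betw f {p, q, c, d} {0, 1, k + 2, 2}"
    using \<open>k \<ge> 1\<close> unfolding bij_betw_def inj_on_def by (auto simp: f)
  ultimately have "bij_betw f V ({3..<k + 2} \<union> {0, 1, k + 2, 2})"
    unfolding assms(2) by (rule bij_betw_combine) auto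
  moreover have "{3..<k + 2} \<union> {0, 1, k + 2, 2} = SK2_V k"
    using \<open>k \<ge> 1\<close> unfolding SK2_V_def by auto
  moreover have "{u, v} \<in> E \<longleftrightarrow> {f u, f v} \<in> SK2_E k" if "u \<in> V" "v \<in> V" for u v
  proof -
    have label: "(f x = 0 \<longleftrightarrow> x = p) \<and> (f x = 1 \<longleftrightarrow> x = q) \<and> (f x = 2 \<longleftrightarrow> x = d)
      \<and> (f x = k + 2 \<longleftrightarrow> x = c) \<and> (f x \<in> {3..<k + 2} \<longleftrightarrow> x \<in> M)" if "x \<in> V" for x
    proof (cases "x \<in> M")
      case True
      then have "f x \<in> {3..<k + 2}" "x \<notin> {p, q, c, d}"
        using bij_betwE[OF M] assms(4) by blast+
      then show ?thesis using True by auto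
    next
      case False
      then have "x = p \<or> x = q \<or> x = c \<or> x = d" using that assms(2) by blast
      then show ?thesis
        using False assms(3) \<open>k \<ge> 1\<close> by (elim disjE) (auto simp: f)
    qed
    show ?thesis
      unfolding adj mem_SK2_E[OF \<open>k \<ge> 1\<close>] P
      using label[OF that(1)] label[OF that(2)] by presburger
  qed
  ultimately show ?thesis unfolding graph_iso_def by metis
qed

section \<open>The cubic polynomial and its largest root\<close>

definition cubic :: "nat \<Rightarrow> real \<Rightarrow> real" where
  "cubic m x = x ^ 3 - x ^ 2 - (real m - 2) * x + real m - 3"

text \<open>This form makes the value -1 at \<open>sqrt (m - 2)\<close> visible for
  \<open>m \<ge> 2\<close>, and the negative sign whenever \<open>x > 1\<close> and
  \<open>x^2 \<le> m - 2\<close>.\<close>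

lemma cubic_factored: "cubic m x = (x - 1) * (x\<^sup>2 - (real m - 2)) - 1"
  by (simp add: cubic_def algebra_simps power2_eq_square power3_eq_cube)

lemma cubic_root_ge:
  assumes "cubic m l \<le> 0"
  shows "\<exists>x\<ge>l. cubic m x = 0"
proof -
  \<comment> \<open>From \<open>m + 2\<close> on, both factors of the cubic are at least 1, so the
    cubic is nonnegative at \<open>b\<close> and the intermediate value theorem applies on
    \<open>{l..b}\<close>.\<close>
  define b where "b = max l (real m + 2)"
  have b: "b \<ge> real m + 2" "b \<ge> l" by (auto simp: b_def)
  have "1 * 1 \<le> (b - 1) * (b\<^sup>2 - (real m - 2))"
  proof (rule mult_mono)
    have "1 * b \<le> b * b" using b by (intro mult_right_mono) auto
    then show "1 \<le> b\<^sup>2 - (real m - 2)" using b unfolding power2_eq_square by linarith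
  qed (use b in auto)
  then have "0 \<le> cubic m b" by (simp add: cubic_factored)
  moreover have "continuous_on {l..b} (cubic m)"
    unfolding cubic_def by (intro continuous_intros)
  ultimately show ?thesis
    using IVT'[of "cubic m" l 0 b] assms b by auto
qed

lemma finite_cubic_roots: "finite {x. cubic m x = 0}"
proof -
  let ?p = "[:real m - 3, - (real m - 2), -1, 1:]"
  have "cubic m x = poly ?p x" for x
    by (simp add: cubic_def algebra_simps power2_eq_square power3_eq_cube)
  then show ?thesis using poly_roots_finite[of ?p] by simp
qed

lemma rho1_star_alt: "rho1_star m = Max {x. cubic m x = 0}"
  by (simp add: rho1_star_def cubic_def)

text \<open>A nonpositive value at \<open>l\<close> forces a root at or beyond \<open>l\<close>.
  Bounding an eigenvalue thus becomes a sign condition on the cubic.\<close>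

lemma le_rho1_star: "cubic m l \<le> 0 \<Longrightarrow> l \<le> rho1_star m"
  unfolding rho1_star_alt
  using cubic_root_ge[of m l] Max_ge[OF finite_cubic_roots, of _ m] by force

lemma cubic_rho1_star:
  assumes "m \<ge> 2"
  shows "cubic m (rho1_star m) = 0"
proof -
  \<comment> \<open>The cubic equals -1 at this point, so it has a root and the \<open>Max\<close>
    is attained.\<close>
  have "cubic m (sqrt (real m - 2)) \<le> 0"
    using assms by (simp add: cubic_factored)
  then have "{x. cubic m x = 0} \<noteq> {}" using cubic_root_ge by blast
  then show ?thesis
    unfolding rho1_star_alt using Max_in[OF finite_cubic_roots, of m] by blast
qed

lemma rho1_star_gt_1:
  assumes "m > 3"
  shows "rho1_star m > 1"
proof -
  have "cubic m (sqrt (real m - 2)) \<le> 0"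
    using assms by (simp add: cubic_factored)
  then have "sqrt (real m - 2) \<le> rho1_star m" by (rule le_rho1_star)
  moreover have "sqrt (real m - 2) > 1" using assms by simp
  ultimately show ?thesis by linarith
qed

text \<open>The hypotheses are the eigenvector equations at \<open>u, w1, w2\<close> for the graph with edge \<open>w1 w2\<close> in which
  \<open>u\<close> has \<open>a\<close> common neighbours with \<open>w1\<close> and \<open>b\<close> with \<open>w2\<close>, multiplied by \<open>l\<close> to eliminate
  the entries at these common neighbours; the entries at \<open>u, w1, w2\<close> are \<open>1, z1, z2\<close>.\<close>

lemma cubic_nonpos_of_eigen_equations:
  fixes a b m :: nat and l z1 z2 :: real
  assumes "l\<^sup>2 = a * (1 + z1) + b * (1 + z2)"
    and "l\<^sup>2 * z1 = a * (1 + z1) + l * z2" and "l\<^sup>2 * z2 = b * (1 + z2) + l * z1"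
    and "l > 1" "a > 0" "b > 0" and m: "m = 2 * a + 2 * b + 1"
  shows "cubic m l \<le> 0" and "cubic m l = 0 \<longleftrightarrow> a = 1 \<or> b = 1"
proof -
  \<comment> \<open>\<open>D\<close> is the determinant of the linear system \<open>e1\<close>,
    \<open>e2\<close> in \<open>z1\<close>, \<open>z2\<close>. Cramer's rule is kept in the product
    form \<open>D * z1\<close>, \<open>D * z2\<close>, so that \<open>D = 0\<close> needs no
    separate treatment.\<close>
  define t D where "t = l\<^sup>2" and "D = (t - a) * (t - b) - t"
  have e1: "(t - a) * z1 = a + l * z2" and e2: "(t - b) * z2 = b + l * z1"
    and e3: "t - a - b = a * z1 + b * z2"
    using assms(1-3) unfolding t_def by (auto simp: algebra_simps)
  have "D * z1 = (t - b) * ((t - a) * z1) - t * z1" by (simp add: D_def algebra_simps)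
  also have "\<dots> = (t - b) * a + l * ((t - b) * z2) - t * z1"
    unfolding e1 by (simp add: algebra_simps)
  also have "\<dots> = (t - b) * a + l * b"
    unfolding e2 by (simp add: t_def algebra_simps power2_eq_square)
  finally have z1: "D * z1 = (t - b) * a + l * b" .
  have "D * z2 = (t - a) * ((t - b) * z2) - t * z2" by (simp add: D_def algebra_simps)
  also have "\<dots> = (t - a) * b + l * ((t - a) * z1) - t * z2"
    unfolding e2 by (simp add: algebra_simps)
  also have "\<dots> = (t - a) * b + l * a"
    unfolding e1 by (simp add: t_def algebra_simps power2_eq_square)
  finally have z2: "D * z2 = (t - a) * b + l * a" .
  have "D * (t - a - b) = a * (D * z1) + b * (D * z2)"
    unfolding e3 by (simp add: algebra_simps)
  then have "D * (t - a - b) - a * ((t - b) * a + l * b) - b * ((t - a) * b + l * a) = 0"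
    unfolding z1 z2 by simp
  \<comment> \<open>With \<open>z1\<close> and \<open>z2\<close> eliminated, the cubic for
    \<open>m = 2 * a + 2 * b + 1\<close> splits off, together with a defect that vanishes exactly
    when \<open>a = 1\<close> or \<open>b = 1\<close>.\<close>
  moreover have "D * (t - a - b) - a * ((t - b) * a + l * b) - b * ((t - a) * b + l * a)
    = l * (cubic m l * (l\<^sup>2 + l - 1) + (real a - 1) * (real b - 1) * (3 * l - 2))"
    unfolding D_def t_def cubic_def m by (simp add: algebra_simps eval_nat_numeral)
  ultimately have key:
    "cubic m l * (l\<^sup>2 + l - 1) + (real a - 1) * (real b - 1) * (3 * l - 2) = 0"
    using \<open>l > 1\<close> by simp
  have pos: "l\<^sup>2 + l - 1 > 0" "3 * l - 2 > 0"
    using \<open>l > 1\<close> by (auto intro: add_pos_pos simp: add_diff_eq[symmetric])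
  have "(real a - 1) * (real b - 1) * (3 * l - 2) \<ge> 0"
    using assms(5,6) pos by (intro mult_nonneg_nonneg) auto
  then have "cubic m l * (l\<^sup>2 + l - 1) \<le> 0" using key by linarith
  then show "cubic m l \<le> 0" using pos by (simp add: mult_le_0_iff)
  show "cubic m l = 0 \<longleftrightarrow> a = 1 \<or> b = 1"
    using key pos by auto
qed

section \<open>Eigenvectors of the extremal graphs\<close>

lemma K2_neighbours:
  shows "u \<le> 1 \<Longrightarrow> {w \<in> K2_V k. {u, w} \<in> K2_E k} = {2..k + 1}"
    and "2 \<le> u \<Longrightarrow> u \<le> k + 1 \<Longrightarrow> {w \<in> K2_V k. {u, w} \<in> K2_E k} = {0, 1}"
  unfolding set_eq_iff mem_Collect_eq mem_K2_E K2_V_def insert_iff empty_iff atLeastAtMost_iff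
  by presburger+

lemma sqrt_mem_adj_eigenvalues_K2:
  assumes "k > 0"
  shows "sqrt (real (2 * k)) \<in> adj_eigenvalues (K2_V k) (K2_E k)"
proof -
  have fin: "finite (K2_V k)" by (simp add: K2_V_def)
  define l where "l = sqrt (real (2 * k))"
  have l: "l * l = 2 * real k" "l > 0" using assms by (auto simp: l_def)
  \<comment> \<open>Constant on each side: the \<open>k\<close> vertices with entry 2 sum to
    \<open>2 * k = l * l\<close>, and the two hubs sum to \<open>2 * l\<close>.\<close>
  define x where "x i = (if i \<le> 1 then l else 2)" for i :: nat
  have "sum x {w \<in> K2_V k. {u, w} \<in> K2_E k} = l * x u" if u: "u \<in> K2_V k" for u
  proof (cases "u \<le> 1")
    case True
    then have "{w \<in> K2_V k. {u, w} \<in> K2_E k} = {2..k + 1}"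
      by (rule K2_neighbours)
    moreover have "sum x {2..k + 1} = (\<Sum>i\<in>{2..k + 1}. 2)"
      by (intro sum.cong) (auto simp: x_def)
    ultimately show ?thesis using True l by (simp add: x_def)
  next
    case False
    then have "{w \<in> K2_V k. {u, w} \<in> K2_E k} = {0, 1}"
      using K2_neighbours(2) u by (simp add: K2_V_def)
    then show ?thesis using False by (simp add: x_def)
  qed
  moreover have "0 \<in> K2_V k" "x 0 \<noteq> 0" using l by (auto simp: K2_V_def x_def)
  ultimately show ?thesis
    unfolding l_def[symmetric] adj_eigenvalues_iff[OF fin] by (intro exI[of _ x]) blast
qed

lemma SK2_neighbours:
  assumes "k \<ge> 1"
  shows "{w \<in> SK2_V k. {0, w} \<in> SK2_E k} = insert (k + 2) {3..<k + 2}"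
    and "{w \<in> SK2_V k. {1, w} \<in> SK2_E k} = insert 2 {3..<k + 2}"
    and "{w \<in> SK2_V k. {2, w} \<in> SK2_E k} = {1, k + 2}"
    and "{w \<in> SK2_V k. {k + 2, w} \<in> SK2_E k} = {0, 2}"
    and "3 \<le> u \<Longrightarrow> u < k + 2 \<Longrightarrow> {w \<in> SK2_V k. {u, w} \<in> SK2_E k} = {0, 1}"
  unfolding set_eq_iff mem_Collect_eq mem_SK2_E[OF assms] SK2_V_def insert_iff empty_iff
    atLeastAtMost_iff atLeastLessThan_iff
  using assms by presburger+

lemma cubic_root_mem_adj_eigenvalues_SK2:
  assumes "k > 0" "l > 1" "cubic (2 * k + 1) l = 0"
  shows "l \<in> adj_eigenvalues (SK2_V k) (SK2_E k)"
proof -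
  \<comment> \<open>Invariant under the symmetry that exchanges 0 with 1 and 2 with
    \<open>k + 2\<close>. With these entries the eigenvalue equations at 2, at \<open>k + 2\<close>
    and at the middle vertices hold for every \<open>l\<close>.\<close>
  define x where "x i = (if i = 0 \<or> i = 1 then l * (l - 1) else if i = 2 \<or> i = k + 2 then l
    else 2 * (l - 1))" for i :: nat
  have fin: "finite (SK2_V k)" by (simp add: SK2_V_def)
  have k: "k \<ge> 1" using assms(1) by simp
  have "sum x {3..<k + 2} = (\<Sum>i\<in>{3..<k + 2}. 2 * (l - 1))"
    by (intro sum.cong) (auto simp: x_def)
  then have sum_middle: "sum x {3..<k + 2} = (real k - 1) * (2 * (l - 1))"
    using k by (simp add: of_nat_diff)
  have sum_insert: "sum x (insert j {3..<k + 2}) = l + (real k - 1) * (2 * (l - 1))"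
    if "x j = l" "j \<notin> {3..<k + 2}" for j
    by (simp only: sum.insert[OF finite_atLeastLessThan that(2)] that(1) sum_middle)
  \<comment> \<open>The remaining equation, at the hubs 0 and 1, is the cubic equation for
    \<open>2 * k + 1\<close> edges.\<close>
  have hub: "(real k - 1) * (2 * (l - 1)) + l = l * (l * (l - 1))"
    using assms(3) by (simp add: cubic_def algebra_simps eval_nat_numeral)
  have "sum x {w \<in> SK2_V k. {u, w} \<in> SK2_E k} = l * x u" if "u \<in> SK2_V k" for u
  proof -
    consider "u = 0" | "u = 1" | "u = 2" | "u = k + 2" | "3 \<le> u" "u < k + 2"
      using \<open>u \<in> SK2_V k\<close> k unfolding SK2_V_def by fastforce
    then show ?thesis
    proof cases
      case 1
      have "x (k + 2) = l" "x 0 = l * (l - 1)" by (simp_all add: x_def)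
      then show ?thesis
        unfolding 1 SK2_neighbours(1)[OF k] using sum_insert[of "k + 2"] hub by force
    next
      case 2
      have "x 2 = l" "x 1 = l * (l - 1)" by (simp_all add: x_def)
      then show ?thesis
        unfolding 2 SK2_neighbours(2)[OF k] using sum_insert[of 2] hub by force
    next
      case 3
      then show ?thesis
        unfolding 3 SK2_neighbours(3)[OF k] using k by (simp add: x_def algebra_simps)
    next
      case 4
      then show ?thesis
        unfolding 4 SK2_neighbours(4)[OF k] using k by (simp add: x_def algebra_simps)
    next
      case 5
      then show ?thesis
        unfolding SK2_neighbours(5)[OF k 5] by (simp add: x_def)
    qed
  qed
  moreover have "0 \<in> SK2_V k" "x 0 \<noteq> 0" using assms by (auto simp: SK2_V_def x_def)
  ultimately show ?thesis
    unfolding adj_eigenvalues_iff[OF fin] by (intro exI[of _ x]) blast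
qed

section \<open>Structure of minimally 2-connected graphs\<close>

abbreviation adjacent :: "'a set set \<Rightarrow> 'a \<Rightarrow> 'a \<Rightarrow> bool" where
  "adjacent E \<equiv> \<lambda>x y. {x, y} \<in> E"

lemma reachable_sym: "(adjacent E)\<^sup>*\<^sup>* x y \<Longrightarrow> (adjacent E)\<^sup>*\<^sup>* y x"
proof (induction rule: rtranclp_induct)
  case (step y z)
  then have "adjacent E z y" by (simp add: insert_commute)
  then show ?case using step.IH by (rule converse_rtranclp_into_rtranclp)
qed simp

text \<open>Each use of the deleted edge in a walk is replaced by the given detour between
  \<open>u\<close> and \<open>v\<close>.\<close>

lemma reachable_without_edge:
  assumes "(adjacent E)\<^sup>*\<^sup>* x y" and "(adjacent (E - {{u, v}}))\<^sup>*\<^sup>* u v"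
  shows "(adjacent (E - {{u, v}}))\<^sup>*\<^sup>* x y"
  using assms(1)
proof (induction rule: rtranclp_induct)
  case (step y z)
  have "(adjacent (E - {{u, v}}))\<^sup>*\<^sup>* y z"
  proof (cases "{y, z} = {u, v}")
    case True
    then show ?thesis
      using assms(2) reachable_sym[OF assms(2)] by (auto simp: doubleton_eq_iff)
  qed (use step in auto)
  with step.IH show ?case by simp
qed simp

section \<open>Separators, chords and triangles\<close>

locale minimally_2_connected_graph =
  fixes V :: "'a set" and E :: "'a set set"
  assumes simple: "simple_graph V E" and minimal: "minimally_2_connected V E"
begin

lemma finite_V: "finite V"
  using simple by (simp add: simple_graph_def)

lemma edgeD: "{u, v} \<in> E \<Longrightarrow> u \<in> V \<and> v \<in> V \<and> u \<noteq> v"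
  using simple unfolding simple_graph_def by (fastforce simp: doubleton_eq_iff)

lemma edge_sym: "{u, v} \<in> E \<Longrightarrow> {v, u} \<in> E"
  by (simp add: insert_commute)

lemma edge_cases:
  assumes "e \<in> E"
  obtains u v where "e = {u, v}" "u \<in> V" "v \<in> V" "u \<noteq> v"
  using assms simple unfolding simple_graph_def by blast

lemma finite_E: "finite E"
proof (rule finite_subset)
  show "E \<subseteq> Pow V" by (auto elim!: edge_cases)
qed (simp add: finite_V)

lemma card_V: "card V \<ge> 3"
  using minimal by (simp add: minimally_2_connected_def two_connected_def)

lemma connected_minus_vertex:
  "v \<in> V \<Longrightarrow> connected_graph (V - {v}) (del_vertex_E E v)"
  using minimal by (simp add: minimally_2_connected_def two_connected_def)

lemma exists_other_vertex: "\<exists>x\<in>V. x \<noteq> u \<and> x \<noteq> v"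
proof (rule ccontr)
  assume "\<not> ?thesis"
  then have "V \<subseteq> {u, v}" by blast
  then have "card V \<le> card {u, v}" by (rule card_mono[rotated]) simp
  also have "\<dots> \<le> 2" by (simp add: card_insert_if)
  finally show False using card_V by simp
qed

text \<open>Since \<open>u\<close> is no cut vertex, every other vertex is reached from
  \<open>t\<close> by a walk avoiding \<open>u\<close>, and such a walk never leaves
  \<open>T\<close>. The structure results below apply this to explicit closed sets.\<close>

lemma closed_set_is_everything:
  assumes "u \<in> V" "t \<in> T" "t \<in> V" "t \<noteq> u"
    and closed: "\<And>x y. x \<in> T \<Longrightarrow> {x, y} \<in> E \<Longrightarrow> x \<noteq> u \<Longrightarrow> y \<noteq> u \<Longrightarrow> y \<in> T"
  shows "V - {u} \<subseteq> T"
proof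
  fix y assume "y \<in> V - {u}"
  then have "(adjacent (del_vertex_E E u))\<^sup>*\<^sup>* t y"
    using connected_minus_vertex[OF assms(1)] assms unfolding connected_graph_def by blast
  then show "y \<in> T"
    by (induction rule: rtranclp_induct) (use assms in \<open>auto simp: del_vertex_E_def\<close>)
qed

text \<open>The minimum degree is at least 2: if \<open>n'\<close> were the only possible neighbour
  of \<open>v\<close>, deleting \<open>n'\<close> would isolate \<open>v\<close>.\<close>

lemma exists_other_neighbour:
  assumes "v \<in> V"
  shows "\<exists>y. y \<noteq> n \<and> {v, y} \<in> E"
proof (rule ccontr)
  assume no: "\<not> ?thesis"
  obtain n' where n': "n' \<in> V" "n' \<noteq> v" "\<And>y. {v, y} \<in> E \<Longrightarrow> y = n'"
  \<comment> \<open>If \<open>n\<close> is outside \<open>V\<close> or is \<open>v\<close> itself,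
    then \<open>v\<close> has no neighbour at all and any other vertex serves as
    \<open>n'\<close>.\<close>
  proof (cases "n \<in> V \<and> n \<noteq> v")
    case False
    obtain n' where "n' \<in> V" "n' \<noteq> v" using exists_other_vertex by blast
    moreover have "\<not> {v, y} \<in> E" for y using no edgeD[of v y] False by (cases "y = n") auto
    ultimately show ?thesis using that by blast
  qed (use no that in blast)
  have "V - {n'} \<subseteq> {v}"
    by (rule closed_set_is_everything[of n' v]) (use n'(1,2) assms in \<open>auto dest: n'(3)\<close>)
  then show False using exists_other_vertex[of n' v] by blast
qed

text \<open>The working form of minimality. If \<open>u\<close> and \<open>v\<close> stayed joined
  without their edge after the deletion of any third vertex, the graph without that edge would still
  be 2-connected. Hence no edge is a chord of a cycle.\<close>

lemma edge_separator:
  assumes "{u, v} \<in> E"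
  obtains (separator) x where "x \<in> V" "x \<noteq> u" "x \<noteq> v"
    "\<not> (adjacent (del_vertex_E (E - {{u, v}}) x))\<^sup>*\<^sup>* u v"
proof (rule ccontr)
  assume no: "\<not> thesis"
  let ?F = "E - {{u, v}}"
  have reach: "(adjacent (del_vertex_E ?F x))\<^sup>*\<^sup>* u v" if "x \<in> V" "x \<noteq> u" "x \<noteq> v" for x
    using no that separator by blast
  have remove: "connected_graph W (D - {{u, v}})"
    if "connected_graph W D" "(adjacent (D - {{u, v}}))\<^sup>*\<^sup>* u v" for W D
    using that reachable_without_edge[OF _ that(2)] unfolding connected_graph_def by blast
  obtain x where x: "x \<in> V" "x \<noteq> u" "x \<noteq> v"
    using exists_other_vertex by blast
  have "(adjacent ?F)\<^sup>*\<^sup>* u v"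
    by (rule rtranclp_mono[THEN predicate2D, OF _ reach[OF x]]) (auto simp: del_vertex_E_def)
  then have "connected_graph V ?F"
    using remove minimal by (simp add: minimally_2_connected_def two_connected_def)
  moreover have "connected_graph (V - {w}) (del_vertex_E ?F w)" if "w \<in> V" for w
  proof (cases "w = u \<or> w = v")
    case True
    then have "del_vertex_E ?F w = del_vertex_E E w" by (auto simp: del_vertex_E_def)
    then show ?thesis using connected_minus_vertex[OF that] by simp
  next
    case False
    have *: "del_vertex_E ?F w = del_vertex_E E w - {{u, v}}" by (auto simp: del_vertex_E_def)
    show ?thesis
      using remove[OF connected_minus_vertex[OF that]] reach[OF that] False unfolding * by blast
  qed
  ultimately have "two_connected V ?F"
    using card_V by (simp add: two_connected_def)
  then show False
    using minimal assms by (simp add: minimally_2_connected_def)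
qed

text \<open>The edge \<open>u v\<close> would be a chord of a 6-cycle: its separator cannot lie on
  both paths of length 3, which share only their ends.\<close>

lemma no_theta33:
  assumes "{u, v} \<in> E" "{u, a} \<in> E" "{a, b} \<in> E" "{b, v} \<in> E"
    "{u, c} \<in> E" "{c, d} \<in> E" "{d, v} \<in> E"
    "distinct [u, v, a, b, c, d]"
  shows False
proof -
  obtain x where x: "x \<noteq> u" "x \<noteq> v"
    "\<not> (adjacent (del_vertex_E (E - {{u, v}}) x))\<^sup>*\<^sup>* u v"
    using edge_separator[OF assms(1)] by metis
  define R where "R = adjacent (del_vertex_E (E - {{u, v}}) x)"
  have "R u a \<and> R a b \<and> R b v \<or> R u c \<and> R c d \<and> R d v"
    unfolding R_def del_vertex_E_def using assms x by (auto simp: doubleton_eq_iff)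
  then have "R\<^sup>*\<^sup>* u v"
    by (meson converse_rtranclp_into_rtranclp r_into_rtranclp)
  then show False using x(3) unfolding R_def by simp
qed

text \<open>The same argument for a chord of a 7-cycle, with paths of lengths 3 and 4 between its
  ends.\<close>

lemma no_theta34:
  assumes "{u, v} \<in> E" "{u, a} \<in> E" "{a, b} \<in> E" "{b, v} \<in> E"
    "{u, c} \<in> E" "{c, d} \<in> E" "{d, e} \<in> E" "{e, v} \<in> E"
    "distinct [u, v, a, b, c, d, e]"
  shows False
proof -
  obtain x where x: "x \<noteq> u" "x \<noteq> v"
    "\<not> (adjacent (del_vertex_E (E - {{u, v}}) x))\<^sup>*\<^sup>* u v"
    using edge_separator[OF assms(1)] by metis
  define R where "R = adjacent (del_vertex_E (E - {{u, v}}) x)"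
  have "R u a \<and> R a b \<and> R b v \<or> R u c \<and> R c d \<and> R d e \<and> R e v"
    unfolding R_def del_vertex_E_def using assms x by (auto simp: doubleton_eq_iff)
  then have "R\<^sup>*\<^sup>* u v"
    by (meson converse_rtranclp_into_rtranclp r_into_rtranclp)
  then show False using x(3) unfolding R_def by simp
qed

text \<open>Since \<open>p\<close> is no cut vertex, a walk from \<open>z\<close> returns to the
  triangle at \<open>q\<close> or \<open>r\<close>. Closed up through the third vertex of the
  triangle, it gives a cycle with a side of the triangle as a chord.\<close>

lemma triangle_vertex_has_no_other_neighbour:
  assumes "{p, q} \<in> E" "{q, r} \<in> E" "{p, r} \<in> E" "{p, z} \<in> E" "z \<notin> {p, q, r}"
  shows False
proof -
  \<comment> \<open>The vertices reachable from \<open>z\<close> off the triangle. As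
    \<open>T\<close> misses \<open>q\<close>, some edge avoiding \<open>p\<close> leaves
    \<open>T\<close>, and its outer end must be \<open>q\<close> or \<open>r\<close>.\<close>
  define T where "T = {y. (adjacent {e \<in> E. p \<notin> e \<and> q \<notin> e \<and> r \<notin> e})\<^sup>*\<^sup>* z y}"
  have "z \<in> T" by (simp add: T_def)
  have T_avoids: "y \<notin> {p, q, r}" if "y \<in> T" for y
    using that assms(5) unfolding T_def mem_Collect_eq
    by (induction rule: rtranclp_induct) auto
  have "\<not> V - {p} \<subseteq> T"
    using T_avoids[of q] edgeD[OF assms(1)] by blast
  then obtain y y' where y: "y \<in> T" "{y, y'} \<in> E" "y' \<noteq> p" "y' \<notin> T"
    using closed_set_is_everything[of p z T] \<open>z \<in> T\<close> edgeD[OF assms(4)] by metis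
  have "y' \<in> {q, r}"
  proof (rule ccontr)
    assume "y' \<notin> {q, r}"
    then have "{y, y'} \<in> {e \<in> E. p \<notin> e \<and> q \<notin> e \<and> r \<notin> e}"
      using y T_avoids[OF y(1)] by auto
    then have "y' \<in> T"
      using y(1) unfolding T_def mem_Collect_eq[of _ "\<lambda>y. rtranclp _ z y"]
      by (rule rtranclp.rtrancl_into_rtrancl[rotated])
    then show False using y by simp
  qed
  then obtain s where s: "{p, y'} \<in> E" "{p, s} \<in> E" "{s, y'} \<in> E" "{y', s} = {q, r}"
    using assms edge_sym by blast
  obtain x where x: "x \<noteq> p" "x \<noteq> y'"
    "\<not> (adjacent (del_vertex_E (E - {{p, y'}}) x))\<^sup>*\<^sup>* p y'"
    using edge_separator[OF s(1)] by metis
  define R where "R = adjacent (del_vertex_E (E - {{p, y'}}) x)"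
  have "s \<noteq> p" "s \<noteq> y'" using s edgeD by blast+
  \<comment> \<open>The path \<open>p\<close>, \<open>s\<close>, \<open>y'\<close> forces the
    separator to be \<open>s\<close>, but the route from \<open>p\<close> to \<open>y'\<close>
    through \<open>T\<close> avoids \<open>s\<close>.\<close>
  have "x = s"
  proof (rule ccontr)
    assume "x \<noteq> s"
    then have "R p s" "R s y'"
      unfolding R_def del_vertex_E_def using s x \<open>s \<noteq> p\<close> \<open>s \<noteq> y'\<close>
      by (auto simp: doubleton_eq_iff)
    then show False using x(3) unfolding R_def by (meson converse_rtranclp_into_rtranclp r_into_rtranclp)
  qed
  have pqr: "{p, q, r} = {p, s, y'}" using s(4) by auto
  have "R\<^sup>*\<^sup>* z y"
    using y(1) unfolding T_def mem_Collect_eq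
    by (rule rtranclp_mono[THEN predicate2D, rotated])
      (use s(4) in \<open>auto simp: R_def del_vertex_E_def \<open>x = s\<close> doubleton_eq_iff\<close>)
  moreover have "R p z" "R y y'"
    unfolding R_def del_vertex_E_def \<open>x = s\<close>
    using assms(4,5) y(2) T_avoids[OF y(1)] \<open>s \<noteq> p\<close> \<open>s \<noteq> y'\<close> unfolding pqr
    by (auto simp: doubleton_eq_iff)
  ultimately have "R\<^sup>*\<^sup>* p y'"
    by (meson converse_rtranclp_into_rtranclp rtranclp.rtrancl_into_rtrancl)
  then show False using x(3) unfolding R_def by simp
qed

text \<open>No vertex of the triangle has a neighbour outside it, so by connectedness the triangle
  is the whole graph.\<close>

lemma triangle_card_E:
  assumes "{u, v} \<in> E" "{v, w} \<in> E" "{u, w} \<in> E"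
  shows "card E = 3"
proof -
  have distinct: "u \<noteq> v" "v \<noteq> w" "u \<noteq> w" using assms edgeD by blast+
  have nbrs: "y \<in> {u, v, w}" if "{x, y} \<in> E" "x \<in> {u, v, w}" for x y
    using that assms triangle_vertex_has_no_other_neighbour[of u v w y]
      triangle_vertex_has_no_other_neighbour[of v u w y]
      triangle_vertex_has_no_other_neighbour[of w u v y]
    by (auto simp: insert_commute)
  have "V - {u} \<subseteq> {u, v, w}"
    by (rule closed_set_is_everything[of u v]) (use nbrs distinct edgeD[OF assms(1)] in auto)
  then have "V \<subseteq> {u, v, w}" by blast
  then have "E \<subseteq> {{u, v}, {v, w}, {u, w}}"
    by (auto elim!: edge_cases simp: doubleton_eq_iff)
  then have "E = {{u, v}, {v, w}, {u, w}}" using assms by blast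
  then show ?thesis
    using distinct by (simp add: card_insert_if doubleton_eq_iff)
qed

end

section \<open>Neighbourhoods and the edges that miss them\<close>

context minimally_2_connected_graph
begin

definition nbrs :: "'a \<Rightarrow> 'a set" where
  "nbrs u = {w. {u, w} \<in> E}"

text \<open>The number of these edges is what the bound on \<open>l^2\<close> gains over
  \<open>card E\<close>.\<close>

definition far_edges :: "'a \<Rightarrow> 'a set set" where
  "far_edges u = {e \<in> E. e \<inter> nbrs u = {}}"

lemma nbrs_subset: "nbrs u \<subseteq> V"
  unfolding nbrs_def using edgeD by blast

lemma finite_nbrs: "finite (nbrs u)"
  using nbrs_subset finite_V by (rule finite_subset)

lemma nbrs_sym: "w \<in> nbrs u \<longleftrightarrow> u \<in> nbrs w"
  by (simp add: nbrs_def insert_commute)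

lemma nbrs_irrefl: "u \<notin> nbrs u"
  unfolding nbrs_def using edgeD by blast

lemma other_nbr: "v \<in> V \<Longrightarrow> \<exists>y \<in> nbrs v. y \<noteq> n"
  using exists_other_neighbour[of v n] unfolding nbrs_def by blast

lemma card_edges_at: "card {e \<in> E. n \<in> e} = card (nbrs n)"
proof -
  have "{e \<in> E. n \<in> e} = (\<lambda>w. {n, w}) ` nbrs n"
  proof (intro equalityI subsetI)
    fix e assume e: "e \<in> {e \<in> E. n \<in> e}"
    then obtain w where "e = {n, w}"
      by (metis (no_types, lifting) edge_cases insertE insert_commute mem_Collect_eq singletonD)
    then show "e \<in> (\<lambda>w. {n, w}) ` nbrs n" using e by (auto simp: nbrs_def)
  qed (auto simp: nbrs_def)
  moreover have "inj_on (\<lambda>w. {n, w}) (nbrs n)"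
    by (auto simp: inj_on_def doubleton_eq_iff)
  ultimately show ?thesis by (simp add: card_image)
qed

end

text \<open>By \<open>triangle_card_E\<close>, excluding this one edge count excludes all triangles;
  both parts of the theorem can supply it from the number of edges alone.\<close>

locale triangle_free_minimally_2_connected_graph = minimally_2_connected_graph +
  assumes card_E_not_3: "card E \<noteq> 3"
begin

lemma no_triangle: "v \<in> nbrs u \<Longrightarrow> w \<in> nbrs v \<Longrightarrow> w \<notin> nbrs u"
  using triangle_card_E card_E_not_3 unfolding nbrs_def by blast

text \<open>\<open>nbrs u\<close> is independent, so the stars of edges at its vertices are
  disjoint; together they contain exactly the edges outside \<open>far_edges u\<close>.\<close>

lemma sum_degrees_nbrs:
  "(\<Sum>n\<in>nbrs u. card (nbrs n)) + card (far_edges u) = card E"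
proof -
  have "card (\<Union>n\<in>nbrs u. {e \<in> E. n \<in> e}) = (\<Sum>n\<in>nbrs u. card {e \<in> E. n \<in> e})"
  proof (rule card_UN_disjoint)
    show "\<forall>i\<in>nbrs u. \<forall>j\<in>nbrs u. i \<noteq> j \<longrightarrow> {e \<in> E. i \<in> e} \<inter> {e \<in> E. j \<in> e} = {}"
    proof (intro ballI impI, rule ccontr)
      fix i j assume ij: "i \<in> nbrs u" "j \<in> nbrs u" "i \<noteq> j"
        "{e \<in> E. i \<in> e} \<inter> {e \<in> E. j \<in> e} \<noteq> {}"
      then obtain e where e: "e \<in> E" "i \<in> e" "j \<in> e" by blast
      then have "e = {i, j}"
        using \<open>i \<noteq> j\<close> by (elim edge_cases) auto
      then have "{i, j} \<in> E" using e by simp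
      then show False using no_triangle[OF ij(1)] ij(2) by (simp add: nbrs_def)
    qed
  qed (use finite_nbrs finite_E in auto)
  moreover have "(\<Union>n\<in>nbrs u. {e \<in> E. n \<in> e}) \<union> far_edges u = E"
    "(\<Union>n\<in>nbrs u. {e \<in> E. n \<in> e}) \<inter> far_edges u = {}"
    by (auto simp: far_edges_def)
  moreover have "finite (\<Union>n\<in>nbrs u. {e \<in> E. n \<in> e})" "finite (far_edges u)"
    using finite_nbrs finite_E by (auto simp: far_edges_def)
  ultimately show ?thesis
    by (metis (no_types, lifting) card_Un_disjoint card_edges_at sum.cong)
qed

lemma nbr_of_nbr: "n \<in> nbrs u \<Longrightarrow> y \<in> nbrs n \<Longrightarrow> y \<noteq> u \<Longrightarrow> y \<in> V - {u} - nbrs u"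
  using no_triangle nbrs_subset by blast

lemma nbr_of_far:
  assumes "w \<in> V - {u} - nbrs u" "y \<in> nbrs w" "{w, y} \<notin> far_edges u"
  shows "y \<in> nbrs u"
  using assms unfolding far_edges_def by (auto simp: nbrs_def)

text \<open>Otherwise the edge \<open>u n\<close> is a chord of the 6-cycle formed by the paths
  \<open>u\<close>, \<open>n1\<close>, \<open>w\<close>, \<open>n\<close> and \<open>u\<close>,
  \<open>n3\<close>, \<open>w'\<close>, \<open>n\<close>.\<close>

lemma shared_nbr:
  assumes "w \<in> V - {u} - nbrs u" "w' \<in> V - {u} - nbrs u" "w \<noteq> w'"
    "n \<in> nbrs u" "n \<in> nbrs w" "n \<in> nbrs w'"
    "n1 \<in> nbrs u" "n1 \<in> nbrs w" "n1 \<noteq> n" "n3 \<in> nbrs u" "n3 \<in> nbrs w'" "n3 \<noteq> n"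
  shows "n1 = n3"
proof (rule ccontr)
  assume "n1 \<noteq> n3"
  moreover have "u \<notin> {n, n1, n3}" using assms nbrs_irrefl by blast
  moreover have "{w, w'} \<inter> {n, n1, n3} = {}" using assms by blast
  ultimately show False
    using assms no_theta33[of u n n1 w n3 w'] by (auto simp: nbrs_def insert_commute)
qed

text \<open>Otherwise the edge \<open>u n\<close> is a chord of the 7-cycle formed by the paths
  \<open>u\<close>, \<open>n1\<close>, \<open>w\<close>, \<open>n\<close> and \<open>u\<close>,
  \<open>n3\<close>, \<open>b\<close>, \<open>a\<close>, \<open>n\<close>.\<close>

lemma shared_nbr_far_edge:
  assumes "w \<in> V - {u} - nbrs u" "a \<in> V - {u} - nbrs u" "b \<in> V - {u} - nbrs u"
    "distinct [w, a, b]" "a \<in> nbrs b" "n \<in> nbrs u" "n \<in> nbrs w" "n \<in> nbrs a"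
    "n1 \<in> nbrs u" "n1 \<in> nbrs w" "n1 \<noteq> n" "n3 \<in> nbrs u" "n3 \<in> nbrs b"
  shows "n1 = n3"
proof (rule ccontr)
  assume "n1 \<noteq> n3"
  moreover have "u \<notin> {n, n1, n3}" using assms nbrs_irrefl by blast
  moreover have "n3 \<noteq> n" using assms no_triangle[of a b n] nbrs_sym by blast
  moreover have "{w, a, b} \<inter> {n, n1, n3} = {}" using assms by blast
  ultimately show False
    using assms no_theta34[of u n n1 w n3 b a] by (auto simp: nbrs_def insert_commute)
qed

text \<open>\<open>w\<close> has a second neighbour \<open>n1\<close>, and \<open>shared_nbr\<close>
  identifies it with every neighbour of \<open>w'\<close> other than \<open>n\<close>. By symmetry
  the two neighbourhoods coincide.\<close>

lemma nbrs_subset_shared: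
  assumes "w \<in> V - {u} - nbrs u" "w' \<in> V - {u} - nbrs u"
    "nbrs w \<subseteq> nbrs u" "nbrs w' \<subseteq> nbrs u" "n \<in> nbrs w" "n \<in> nbrs w'"
  shows "nbrs w' \<subseteq> nbrs w"
proof (cases "w = w'")
  case False
  show ?thesis
  proof
    fix n3 assume n3: "n3 \<in> nbrs w'"
    obtain n1 where n1: "n1 \<in> nbrs w" "n1 \<noteq> n"
      using other_nbr[of w n] assms(1) by blast
    show "n3 \<in> nbrs w"
    proof (cases "n3 = n")
      case False
      then have "n1 = n3"
        using shared_nbr[OF assms(1,2) \<open>w \<noteq> w'\<close>, of n n1 n3] assms n1 n3 by blast
      then show ?thesis using n1 by simp
    qed (use assms in simp)
  qed
qed simp

text \<open>The graph turns out to be complete bipartite with sides \<open>N\<close> and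
  \<open>insert u W\<close>. Both sides have at least two vertices, and chordlessness keeps one of
  them at exactly two.\<close>

lemma no_far_edges_structure:
  assumes "u \<in> V" "far_edges u = {}"
  shows "even (card E) \<and> graph_iso V E (K2_V (card E div 2)) (K2_E (card E div 2))"
proof -
  define N where "N = nbrs u"
  define W where "W = V - {u} - N"
  note WN = W_def N_def
  have W_nbrs: "nbrs w \<subseteq> N" if "w \<in> W" for w
    using nbr_of_far[of w u] that assms(2) unfolding WN by blast
  have W_complete: "nbrs w = N" if w: "w \<in> W" for w
  proof -
    \<comment> \<open>This set is closed off \<open>u\<close>: a vertex of \<open>W\<close> adjacent
      to a neighbour of \<open>w\<close> shares that neighbour with \<open>w\<close>, so
      \<open>nbrs_subset_shared\<close> applies. It meets \<open>N\<close> only in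
      \<open>nbrs w\<close>, which is therefore all of \<open>N\<close>.\<close>
    let ?T = "nbrs w \<union> {w' \<in> W. nbrs w' \<subseteq> nbrs w}"
    have "V - {u} \<subseteq> ?T"
    proof (rule closed_set_is_everything[of u w])
      fix x y assume xy: "x \<in> ?T" "{x, y} \<in> E" "x \<noteq> u" "y \<noteq> u"
      show "y \<in> ?T"
      proof (cases "x \<in> nbrs w")
        case True
        then have x: "x \<in> N" using W_nbrs[OF w] by blast
        have y: "y \<in> nbrs x" using xy by (simp add: nbrs_def)
        then have "y \<in> W" using nbr_of_nbr[of x u y] x xy unfolding WN by blast
        then show ?thesis
          using nbrs_subset_shared[of w u y x] w W_nbrs True y nbrs_sym unfolding WN by blast
      qed (use xy in \<open>auto simp: nbrs_def\<close>)
    qed (use w assms(1) in \<open>auto simp: WN\<close>)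
    moreover have "N \<subseteq> V - {u}" "N \<inter> W = {}"
      using nbrs_subset nbrs_irrefl unfolding WN by auto
    ultimately show ?thesis using W_nbrs[OF w] by blast
  qed
  have N_nbrs: "nbrs n = insert u W" if "n \<in> N" for n
  proof
    show "nbrs n \<subseteq> insert u W"
      using nbr_of_nbr[of n u] that unfolding WN by blast
    show "insert u W \<subseteq> nbrs n"
      using W_complete that nbrs_sym unfolding N_def by blast
  qed
  have V: "V = N \<union> insert u W" "N \<inter> insert u W = {}" "u \<notin> W"
    using assms(1) nbrs_subset nbrs_irrefl unfolding WN by auto
  have finite: "finite N" "finite W"
    using finite_nbrs finite_V unfolding WN by auto
  have card_E: "card E = card N * card (insert u W)"
    using sum_degrees_nbrs[of u] assms(2) N_nbrs unfolding N_def by simp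
  have adj: "{x, y} \<in> E \<longleftrightarrow> x \<in> N \<and> y \<in> insert u W \<or> y \<in> N \<and> x \<in> insert u W" for x y
  proof -
    have "{x, y} \<in> E \<longleftrightarrow> y \<in> nbrs x" by (simp add: nbrs_def)
    then show ?thesis
      using N_nbrs W_complete nbrs_sym[of y x] V N_def nbrs_subset by blast
  qed
  obtain n where n: "n \<in> N" using other_nbr[OF assms(1)] unfolding N_def by blast
  obtain n1 where n1: "n1 \<in> N" "n1 \<noteq> n" using other_nbr[OF assms(1), of n] unfolding N_def by blast
  obtain w where w: "w \<in> W"
    using other_nbr[of n u] N_nbrs n nbrs_subset unfolding N_def by blast
  show ?thesis
  \<comment> \<open>In the first case \<open>u\<close> and \<open>w\<close> are the side of size
    two. In the second, a third vertex of \<open>N\<close> would contradict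
    \<open>shared_nbr\<close> for \<open>w\<close> and \<open>w'\<close>.\<close>
  proof (cases "W = {w}")
    case True
    have "graph_iso V E (K2_V (card E div 2)) (K2_E (card E div 2))"
    proof (rule graph_iso_K2I[of N _ u w])
      show "card N = card E div 2" using card_E True V by simp
    qed (use V True finite adj in auto)
    then show ?thesis using card_E True V by simp
  next
    case False
    then obtain w' where w': "w' \<in> W" "w' \<noteq> w" using w by blast
    have N: "N = {n, n1}"
    proof (rule ccontr)
      assume "N \<noteq> {n, n1}"
      then obtain n3 where "n3 \<in> N" "n3 \<noteq> n" "n3 \<noteq> n1" using n n1 by blast
      then show False
        using shared_nbr[of w u w' n n1 n3] w w' W_complete n n1 unfolding WN by blast
    qed
    have "graph_iso V E (K2_V (card E div 2)) (K2_E (card E div 2))"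
    proof (rule graph_iso_K2I[of "insert u W" _ n n1])
      show "card (insert u W) = card E div 2" using card_E n1 unfolding N by simp
    qed (use V N n1 finite adj in auto)
    then show ?thesis using card_E n1 unfolding N by simp
  qed
qed

text \<open>Suppose there is a further vertex \<open>w\<close> outside \<open>nbrs u\<close>. If no
  neighbour of \<open>w\<close> is adjacent to an end of the far edge, \<open>w\<close> cannot reach
  \<open>w1\<close> off \<open>u\<close>. Otherwise chordlessness leaves \<open>w\<close> only two
  neighbours, and these exhaust \<open>nbrs u\<close>.\<close>

lemma unique_far_edge_structure:
  assumes "u \<in> V" "far_edges u = {{w1, w2}}" "card (nbrs u) \<ge> 3"
  shows "V = {u, w1, w2} \<union> nbrs u"
proof -
  define N where "N = nbrs u"
  define W where "W = V - {u} - N"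
  note WN = W_def N_def
  have edge: "{w1, w2} \<in> E" and not_N: "w1 \<notin> N" "w2 \<notin> N"
    using assms(2) unfolding far_edges_def WN by auto
  have u_end: "w1 \<noteq> u" "w2 \<noteq> u"
    using edge edge_sym[OF edge] not_N unfolding N_def nbrs_def by auto
  have w12: "w1 \<in> W" "w2 \<in> W" "w1 \<noteq> w2" "w1 \<in> nbrs w2" "w2 \<in> nbrs w1"
    using edge edge_sym[OF edge] not_N edgeD[OF edge] u_end unfolding WN nbrs_def by auto
  have far: "{x, y} \<in> far_edges u \<longleftrightarrow> x = w1 \<and> y = w2 \<or> x = w2 \<and> y = w1" for x y
    by (simp add: assms(2) doubleton_eq_iff)
  have W_nbrs: "nbrs w \<subseteq> N" if "w \<in> W" "w \<notin> {w1, w2}" for w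
    using nbr_of_far[of w u] that far[of w] unfolding WN by blast
  have ends_nbrs: "nbrs w1 \<subseteq> insert w2 N" "nbrs w2 \<subseteq> insert w1 N"
    using nbr_of_far[of w1 u] nbr_of_far[of w2 u] w12 far[of w1] far[of w2] unfolding WN by blast+
  have "W \<subseteq> {w1, w2}"
  proof (rule ccontr)
    assume "\<not> W \<subseteq> {w1, w2}"
    then obtain w where w: "w \<in> W" "w \<notin> {w1, w2}" by blast
    let ?S = "{w' \<in> W - {w1, w2}. nbrs w' \<subseteq> nbrs w}"
    have shared: "y \<in> ?S \<union> {w1, w2}" if "x \<in> nbrs w" "{x, y} \<in> E" "y \<noteq> u" for x y
    proof -
      have x: "x \<in> N" using that W_nbrs[OF w] by blast
      have y: "y \<in> nbrs x" using that by (simp add: nbrs_def)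
      then have "y \<in> W" using nbr_of_nbr[of x u y] x that unfolding WN by blast
      then show ?thesis
        using nbrs_subset_shared[of w u y x] w W_nbrs that(1) y nbrs_sym unfolding WN by blast
    qed
    \<comment> \<open>Here \<open>n\<close> is a neighbour that \<open>w\<close> shares with the end
      \<open>a\<close>. The chord \<open>u n\<close> identifies every other neighbour of
      \<open>w\<close> with every neighbour of \<open>b\<close> other than \<open>a\<close>; the
      chord \<open>u m\<close> then gives the same with the ends exchanged.\<close>
    have link: "\<exists>m. nbrs w = {n, m} \<and> nbrs b \<subseteq> {a, m} \<and> nbrs a \<subseteq> {b, n}"
      if ab: "{a, b} = {w1, w2}" and n: "n \<in> nbrs w" "n \<in> nbrs a" for a b n
    proof -
      have ab': "a \<in> W" "b \<in> W" "distinct [w, a, b]" "distinct [w, b, a]"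
        "a \<in> nbrs b" "b \<in> nbrs a" "nbrs a \<subseteq> insert b N" "nbrs b \<subseteq> insert a N"
        using ab w12 w ends_nbrs by (auto simp: doubleton_eq_iff)
      have wN: "nbrs w \<subseteq> N" using W_nbrs w by blast
      obtain m where m: "m \<in> nbrs w" "m \<noteq> n" using other_nbr[of w n] w unfolding WN by blast
      have eq: "n1 = n3" if "n1 \<in> nbrs w" "n1 \<noteq> n" "n3 \<in> nbrs b" "n3 \<noteq> a" for n1 n3
        using shared_nbr_far_edge[of w u a b n n1 n3] w ab' n that wN unfolding WN by blast
      obtain n3 where n3: "n3 \<in> nbrs b" "n3 \<noteq> a"
        using other_nbr[of b a] ab' unfolding WN by blast
      have m': "m \<in> nbrs b" using eq[OF m n3] n3 by simp
      have "nbrs w = {n, m}" using eq[OF _ _ n3] m n by blast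
      moreover have "nbrs b \<subseteq> {a, m}" using eq[OF m] by blast
      moreover have "n3 = n" if "n3 \<in> nbrs a" "n3 \<noteq> b" for n3
        using shared_nbr_far_edge[of w u b a m n n3] w ab' n m m' that wN unfolding WN by blast
      ultimately show ?thesis by blast
    qed
    \<comment> \<open>One statement for both cases: \<open>T\<close> must contain \<open>w1\<close>
      and all of \<open>N\<close>, so either \<open>w1\<close> is missing from it, or
      \<open>N\<close> lies in a \<open>nbrs w\<close> of at most two elements. Both are
      contradictory.\<close>
    have "\<exists>T. V - {u} \<subseteq> T \<and> T \<inter> N \<subseteq> nbrs w \<and> (w1 \<in> T \<longrightarrow> card (nbrs w) \<le> 2)"
    proof (cases "\<exists>n\<in>nbrs w. n \<in> nbrs w1 \<or> n \<in> nbrs w2")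
      case False
      have "V - {u} \<subseteq> nbrs w \<union> ?S"
      proof (rule closed_set_is_everything[of u w])
        fix x y assume xy: "x \<in> nbrs w \<union> ?S" "{x, y} \<in> E" "x \<noteq> u" "y \<noteq> u"
        show "y \<in> nbrs w \<union> ?S"
        proof (cases "x \<in> nbrs w")
          case True
          then show ?thesis
            using shared[OF True xy(2,4)] False xy(2) nbrs_sym unfolding nbrs_def by blast
        qed (use xy in \<open>auto simp: nbrs_def\<close>)
      qed (use w assms(1) in \<open>auto simp: WN\<close>)
      moreover have "w1 \<notin> nbrs w \<union> ?S"
        using not_N W_nbrs[OF w] by blast
      ultimately show ?thesis by (intro exI[of _ "nbrs w \<union> ?S"]) (auto simp: WN)
    next
      case True
      then obtain a b n where "{a, b} = {w1, w2}" "n \<in> nbrs w" "n \<in> nbrs a"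
        by (metis insert_commute)
      from this(1) link[OF this] obtain m where ab: "{a, b} = {w1, w2}"
        and nm: "nbrs w = {n, m}" "nbrs b \<subseteq> {a, m}" "nbrs a \<subseteq> {b, n}" by blast
      let ?T = "nbrs w \<union> ?S \<union> {w1, w2}"
      have "V - {u} \<subseteq> ?T"
      proof (rule closed_set_is_everything[of u w])
        fix x y assume xy: "x \<in> ?T" "{x, y} \<in> E" "x \<noteq> u" "y \<noteq> u"
        then consider "x \<in> nbrs w" | "x \<in> ?S" | "x = a" | "x = b"
          using ab by blast
        then show "y \<in> ?T"
        proof cases
          case 1
          then show ?thesis using shared[OF 1 xy(2,4)] by blast
        qed (use xy ab nm in \<open>auto simp: nbrs_def\<close>)
      qed (use w assms(1) in \<open>auto simp: WN\<close>)
      moreover have "card (nbrs w) \<le> 2"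
        unfolding nm by (simp add: card_insert_if)
      ultimately show ?thesis
        using not_N by (intro exI[of _ ?T]) (auto simp: WN)
    qed
    then obtain T where T: "V - {u} \<subseteq> T" "T \<inter> N \<subseteq> nbrs w"
      and card_le: "w1 \<in> T \<longrightarrow> card (nbrs w) \<le> 2" by blast
    have "w1 \<in> T" using T w12 unfolding W_def by blast
    moreover have "N \<subseteq> nbrs w" using T nbrs_subset nbrs_irrefl unfolding N_def by blast
    then have "card N \<le> card (nbrs w)" by (rule card_mono[OF finite_nbrs])
    ultimately show False using card_le assms(3) unfolding N_def by simp
  qed
  then show ?thesis using w12 assms(1) nbrs_subset unfolding WN by blast
qed

end

section \<open>Bounding the eigenvalues\<close>

context minimally_2_connected_graph
begin

text \<open>Division by an entry of largest absolute value, sign included, turns that entry into 1.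
  This works for every eigenvalue.\<close>

lemma normalized_eigenvector:
  assumes "l \<in> adj_eigenvalues V E"
  obtains u x where "u \<in> V" "x u = 1" "\<And>v. v \<in> V \<Longrightarrow> \<bar>x v\<bar> \<le> 1"
    "\<And>v. v \<in> V \<Longrightarrow> sum x (nbrs v) = l * x v"
proof -
  have nbrs_V: "{w \<in> V. {v, w} \<in> E} = nbrs v" for v
    using nbrs_subset unfolding nbrs_def by blast
  obtain x where nz: "\<exists>u\<in>V. x u \<noteq> 0" and x: "\<And>v. v \<in> V \<Longrightarrow> sum x (nbrs v) = l * x v"
    using assms unfolding adj_eigenvalues_iff[OF finite_V] nbrs_V by blast
  have ne: "(\<lambda>v. \<bar>x v\<bar>) ` V \<noteq> {}" "finite ((\<lambda>v. \<bar>x v\<bar>) ` V)" using nz finite_V by auto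
  obtain u where u: "u \<in> V" "\<bar>x u\<bar> = Max ((\<lambda>v. \<bar>x v\<bar>) ` V)"
    using Max_in[OF ne(2,1)] by (metis (no_types, lifting) imageE)
  have le: "\<bar>x v\<bar> \<le> \<bar>x u\<bar>" if "v \<in> V" for v
    unfolding u(2) using that ne by (intro Max_ge) auto
  have "x u \<noteq> 0" using nz le by force
  show ?thesis
  proof (rule that[of u "\<lambda>v. x v / x u"])
    show "\<bar>x v / x u\<bar> \<le> 1" if "v \<in> V" for v
      using le[OF that] \<open>x u \<noteq> 0\<close> by (simp add: field_simps)
    show "(\<Sum>w\<in>nbrs v. x w / x u) = l * (x v / x u)" if "v \<in> V" for v
      using x[OF that] by (simp add: sum_divide_distrib[symmetric])
  qed (use u \<open>x u \<noteq> 0\<close> in auto)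
qed

lemma sum_nbrs_le_degree:
  assumes "\<And>v. v \<in> V \<Longrightarrow> \<bar>x v\<bar> \<le> (1::real)"
  shows "sum x (nbrs v) \<le> card (nbrs v)"
proof -
  have "sum x (nbrs v) \<le> (\<Sum>w\<in>nbrs v. 1)"
    using assms nbrs_subset by (intro sum_mono) (meson abs_le_D1 subsetD)
  then show ?thesis by simp
qed

text \<open>\<open>l^2 * x u\<close> sums the entries at the ends of all walks of length two from
  \<open>u\<close>, and each entry is at most 1.\<close>

lemma square_eigenvalue_le:
  assumes "u \<in> V" "x u = 1" "\<And>v. v \<in> V \<Longrightarrow> \<bar>x v\<bar> \<le> (1::real)"
    and x: "\<And>v. v \<in> V \<Longrightarrow> sum x (nbrs v) = l * x v"
  shows "l\<^sup>2 \<le> (\<Sum>n\<in>nbrs u. card (nbrs n))"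
proof -
  have "l\<^sup>2 = l * sum x (nbrs u)"
    using x[OF assms(1)] assms(2) by (simp add: power2_eq_square)
  also have "\<dots> = (\<Sum>n\<in>nbrs u. sum x (nbrs n))"
    unfolding sum_distrib_left using x nbrs_subset by (intro sum.cong) (auto simp: subset_eq)
  also have "\<dots> \<le> (\<Sum>n\<in>nbrs u. real (card (nbrs n)))"
    using sum_nbrs_le_degree assms(3) by (intro sum_mono) blast
  finally show ?thesis by simp
qed

end

context triangle_free_minimally_2_connected_graph
begin

lemma adj_eigenvalue_square_le:
  assumes "l \<in> adj_eigenvalues V E"
  shows "l\<^sup>2 \<le> real (card E)"
    and "l\<^sup>2 = real (card E) \<Longrightarrow> graph_iso V E (K2_V (card E div 2)) (K2_E (card E div 2))"
proof -
  obtain u x where u: "u \<in> V" "x u = 1" "\<And>v. v \<in> V \<Longrightarrow> \<bar>x v\<bar> \<le> 1"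
    "\<And>v. v \<in> V \<Longrightarrow> sum x (nbrs v) = l * x v"
    using normalized_eigenvector[OF assms] by blast
  have le: "l\<^sup>2 + card (far_edges u) \<le> real (card E)"
    using square_eigenvalue_le[OF u] sum_degrees_nbrs[of u] by linarith
  then show "l\<^sup>2 \<le> real (card E)" by linarith
  assume "l\<^sup>2 = real (card E)"
  then have "card (far_edges u) = 0" using le by simp
  then have "far_edges u = {}"
    using finite_E by (simp add: far_edges_def)
  then show "graph_iso V E (K2_V (card E div 2)) (K2_E (card E div 2))"
    using no_far_edges_structure u(1) by blast
qed

lemma adj_eigenvalue_cubic_le:
  assumes "l \<in> adj_eigenvalues V E" "l > 1" "odd (card E)" "card E \<ge> 9"
  shows "cubic (card E) l \<le> 0"
    and "cubic (card E) l = 0 \<Longrightarrow>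
      graph_iso V E (SK2_V ((card E - 1) div 2)) (SK2_E ((card E - 1) div 2))"
proof -
  let ?iso = "graph_iso V E (SK2_V ((card E - 1) div 2)) (SK2_E ((card E - 1) div 2))"
  obtain u x where u: "u \<in> V" "x u = 1" "\<And>v. v \<in> V \<Longrightarrow> \<bar>x v\<bar> \<le> 1"
    and x: "\<And>v. v \<in> V \<Longrightarrow> sum x (nbrs v) = l * x v"
    using normalized_eigenvector[OF assms(1)] by blast
  have le: "l\<^sup>2 + card (far_edges u) \<le> real (card E)"
    using square_eigenvalue_le[OF u x] sum_degrees_nbrs[of u] by linarith
  have "cubic (card E) l \<le> 0 \<and> (cubic (card E) l = 0 \<longrightarrow> ?iso)"
  \<comment> \<open>By \<open>le\<close>, two or more far edges lead to the first case, where the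
    cubic is at most -1 and equality cannot occur.\<close>
  proof (cases "l\<^sup>2 \<le> real (card E) - 2")
    case True
    then have "(l - 1) * (l\<^sup>2 - (real (card E) - 2)) \<le> 0"
      using assms(2) by (intro mult_nonneg_nonpos) auto
    then show ?thesis by (simp add: cubic_factored)
  next
    case False
    have "card (far_edges u) \<noteq> 0"
      using no_far_edges_structure[OF u(1)] assms(3) finite_E by (auto simp: far_edges_def)
    then have "card (far_edges u) = 1" using le False by linarith
    then obtain e where e: "far_edges u = {e}" by (rule card_1_singletonE)
    then have "e \<in> E" by (auto simp: far_edges_def)
    then obtain w1 w2 where w: "e = {w1, w2}" "w1 \<noteq> w2" by (elim edge_cases)
    \<comment> \<open>The eigenvalue equation at \<open>u\<close> bounds \<open>l\<close> by the
      degree of \<open>u\<close>. A degree of at most 2 would give \<open>l^2 \<le> 4\<close>,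
      whereas here \<open>l^2 > m - 2 \<ge> 7\<close>.\<close>
    have "l \<le> card (nbrs u)"
      using sum_nbrs_le_degree[of x u] u x[OF u(1)] by simp
    have "card (nbrs u) \<ge> 3"
    proof (rule ccontr)
      assume "\<not> 3 \<le> card (nbrs u)"
      then have "l \<le> 2" using \<open>l \<le> card (nbrs u)\<close> by linarith
      then have "l\<^sup>2 \<le> 2\<^sup>2" using assms(2) by (intro power_mono) auto
      then show False using False assms(4) by simp
    qed
    then have V: "V = {u, w1, w2} \<union> nbrs u"
      by (rule unique_far_edge_structure[OF u(1) e[unfolded w(1)]])
    define A B where "A = nbrs w1 \<inter> nbrs u" and "B = nbrs w2 \<inter> nbrs u"
    have edge12: "{w1, w2} \<in> E" "{w1, w2} \<inter> nbrs u = {}"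
      using e unfolding w far_edges_def by blast+
    then have w12: "w1 \<in> nbrs w2" "w2 \<in> nbrs w1" "w1 \<notin> nbrs u" "w2 \<notin> nbrs u"
      using edge_sym[OF edge12(1)] by (simp_all add: nbrs_def)
    then have w12': "w1 \<noteq> u" "w2 \<noteq> u" "w1 \<in> V" "w2 \<in> V"
      using edgeD[OF edge12(1)] by blast+
    have nbrs_w1: "nbrs w1 = insert w2 A"
      using w12 nbrs_subset[of w1] nbrs_irrefl[of w1] nbrs_sym[of u w1] V
      unfolding A_def by blast
    have nbrs_w2: "nbrs w2 = insert w1 B"
      using w12 nbrs_subset[of w2] nbrs_irrefl[of w2] nbrs_sym[of u w2] V
      unfolding B_def by blast
    note nbrs_w = nbrs_w1 nbrs_w2
    have disj: "A \<inter> B = {}"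
      using no_triangle w12 unfolding A_def B_def by blast
    have nbr_n: "nbrs n \<subseteq> {u, w1, w2}" "u \<in> nbrs n" if "n \<in> nbrs u" for n
      using nbr_of_nbr[OF that] V that nbrs_sym[of u n] by blast+
    have N: "nbrs u = A \<union> B"
    \<comment> \<open>Each neighbour of \<open>u\<close> has a second neighbour, which can only be
      \<open>w1\<close> or \<open>w2\<close>.\<close>
    proof
      show "nbrs u \<subseteq> A \<union> B"
      proof
        fix n assume n: "n \<in> nbrs u"
        then obtain y where "y \<in> nbrs n" "y \<noteq> u" using other_nbr[of n u] nbrs_subset by blast
        then show "n \<in> A \<union> B"
          using nbr_n[OF n] n nbrs_sym unfolding A_def B_def by blast
      qed
    qed (auto simp: A_def B_def)
    have nbrs_A: "nbrs n = {u, w1}" if "n \<in> A" for n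
      using that nbr_n[of n] disj nbrs_sym unfolding A_def B_def by blast
    have nbrs_B: "nbrs n = {u, w2}" if "n \<in> B" for n
      using that nbr_n[of n] disj nbrs_sym unfolding A_def B_def by blast
    have fin: "finite A" "finite B" using finite_nbrs by (auto simp: A_def B_def)
    have "A \<noteq> {}" "B \<noteq> {}"
      using other_nbr[OF w12'(3), of w2] other_nbr[OF w12'(4), of w1] nbrs_w by blast+
    then have card_pos: "card A > 0" "card B > 0" using fin by (auto simp: card_gt_0_iff)
    have card_nbrs: "card (nbrs n) = 2" if "n \<in> nbrs u" for n
      using that nbrs_A nbrs_B w12' unfolding N by auto
    have card_N: "card (nbrs u) = card A + card B"
      unfolding N using fin disj by (rule card_Un_disjoint)
    have m: "card E = 2 * card A + 2 * card B + 1"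
      using sum_degrees_nbrs[of u] e card_nbrs card_N by simp
    have notin: "w1 \<notin> A" "w1 \<notin> B" "w2 \<notin> A" "w2 \<notin> B" "u \<notin> A" "u \<notin> B"
      using w12 nbrs_irrefl unfolding A_def B_def by auto
    have lA: "(\<Sum>n\<in>A. l * x n) = card A * (1 + x w1)"
    proof -
      have "l * x n = 1 + x w1" if "n \<in> A" for n
      proof -
        have "n \<in> V" using that N V by blast
        then have "sum x {u, w1} = l * x n" using x[of n] unfolding nbrs_A[OF that] by blast
        then show ?thesis using u(2) w12' by simp
      qed
      then show ?thesis by simp
    qed
    have lB: "(\<Sum>n\<in>B. l * x n) = card B * (1 + x w2)"
    proof -
      have "l * x n = 1 + x w2" if "n \<in> B" for n
      proof -
        have "n \<in> V" using that N V by blast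
        then have "sum x {u, w2} = l * x n" using x[of n] unfolding nbrs_B[OF that] by blast
        then show ?thesis using u(2) w12' by simp
      qed
      then show ?thesis by simp
    qed
    have eq_u: "l\<^sup>2 = card A * (1 + x w1) + card B * (1 + x w2)"
    proof -
      have "l\<^sup>2 = l * sum x (A \<union> B)"
        using x[OF u(1)] u(2) N by (simp add: power2_eq_square)
      then show ?thesis
        using fin disj by (simp add: sum.union_disjoint distrib_left sum_distrib_left lA lB)
    qed
    have eq_w1: "l\<^sup>2 * x w1 = card A * (1 + x w1) + l * x w2"
    proof -
      have "l\<^sup>2 * x w1 = l * sum x (insert w2 A)"
        using x[OF w12'(3)] nbrs_w by (simp add: power2_eq_square)
      then show ?thesis
        using fin notin by (simp add: distrib_left sum_distrib_left lA)
    qed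
    have eq_w2: "l\<^sup>2 * x w2 = card B * (1 + x w2) + l * x w1"
    proof -
      have "l\<^sup>2 * x w2 = l * sum x (insert w1 B)"
        using x[OF w12'(4)] nbrs_w by (simp add: power2_eq_square)
      then show ?thesis
        using fin notin by (simp add: distrib_left sum_distrib_left lB)
    qed
    note cubic = cubic_nonpos_of_eigen_equations[OF eq_u eq_w1 eq_w2 assms(2) card_pos m]
    have adj: "{a, b} \<in> E \<longleftrightarrow> a \<in> A \<and> b \<in> {u, w1} \<or> a \<in> B \<and> b \<in> {u, w2}
        \<or> b \<in> A \<and> a \<in> {u, w1} \<or> b \<in> B \<and> a \<in> {u, w2} \<or> {a, b} = {w1, w2}" for a b
    proof -
      have edge: "{a, b} \<in> E \<longleftrightarrow> b \<in> nbrs a" by (simp add: nbrs_def)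
      consider "a = u" | "a = w1" | "a = w2" | "a \<in> A" | "a \<in> B" | "a \<notin> V"
        using V N by blast
      then show ?thesis
      proof cases
        case 1
        show ?thesis unfolding edge unfolding 1 N doubleton_eq_iff using notin w12' by blast
      next
        case 2
        show ?thesis unfolding edge unfolding 2 nbrs_w doubleton_eq_iff using notin w12' w(2) by blast
      next
        case 3
        show ?thesis unfolding edge unfolding 3 nbrs_w doubleton_eq_iff using notin w12' w(2) by blast
      next
        case 4
        then have "a \<notin> B" "a \<noteq> u" "a \<noteq> w1" "a \<noteq> w2" using disj notin by auto
        then show ?thesis unfolding edge nbrs_A[OF 4] doubleton_eq_iff using 4 by blast
      next
        case 5
        then have "a \<notin> A" "a \<noteq> u" "a \<noteq> w1" "a \<noteq> w2" using disj notin by auto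
        then show ?thesis unfolding edge nbrs_B[OF 5] doubleton_eq_iff using 5 by blast
      next
        case 6
        then have "{a, b} \<notin> E" using edgeD by blast
        moreover have "a \<notin> A" "a \<notin> B" "a \<notin> {u, w1, w2}"
          using 6 V N by auto
        ultimately show ?thesis unfolding doubleton_eq_iff by blast
      qed
    qed
    \<comment> \<open>The class \<open>B'\<close> is a single vertex \<open>n\<close>, so
      \<open>u\<close>, \<open>n\<close>, \<open>q\<close>, \<open>p\<close> is the path with the
      subdivision, and \<open>u\<close> and \<open>p\<close> are the hubs. The general form serves
      \<open>card A = 1\<close> and \<open>card B = 1\<close> alike.\<close>
    have iso: ?iso
      if "card B' = 1" "finite A'" "nbrs u = A' \<union> B'" "A' \<inter> B' = {}" "{p, q} = {w1, w2}"
        "card E = 2 * card A' + 3"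
        and adj': "\<And>a b. {a, b} \<in> E \<longleftrightarrow> a \<in> A' \<and> b \<in> {u, p} \<or> a \<in> B' \<and> b \<in> {u, q}
        \<or> b \<in> A' \<and> a \<in> {u, p} \<or> b \<in> B' \<and> a \<in> {u, q} \<or> {a, b} = {p, q}"
      for A' B' p q
    proof -
      obtain n where n: "B' = {n}" using \<open>card B' = 1\<close> by (rule card_1_singletonE)
      have pq: "p \<noteq> q" "p \<noteq> u" "q \<noteq> u" "p \<notin> nbrs u" "q \<notin> nbrs u" "u \<notin> nbrs u"
        using \<open>{p, q} = {w1, w2}\<close> w(2) w12 w12' nbrs_irrefl by (auto simp: doubleton_eq_iff)
      show ?thesis
      proof (rule graph_iso_SK2I)
        show "V = A' \<union> {u, p, n, q}"
          using V that(3,5) n by auto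
        show "card A' + 1 = (card E - 1) div 2" using that(6) by simp
        show "distinct [u, p, n, q]" "A' \<inter> {u, p, n, q} = {}"
          using pq that(3,4) n by auto
        show "{a, b} \<in> E \<longleftrightarrow> ((a = u \<or> a = p) \<and> b \<in> A'
            \<or> a = u \<and> b = n \<or> a = n \<and> b = q \<or> a = q \<and> b = p) \<or> ((b = u \<or> b = p) \<and> a \<in> A'
            \<or> b = u \<and> a = n \<or> b = n \<and> a = q \<or> b = q \<and> a = p)" for a b
          unfolding adj' n doubleton_eq_iff by blast
      qed (use that in auto)
    qed
    have ?iso if "cubic (card E) l = 0"
    proof -
      have "card A = 1 \<or> card B = 1" using cubic(2) that by simp
      then show ?thesis
      proof
        assume "card B = 1"
        show ?thesis
        proof (rule iso[of B A w1 w2])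
          show "{a, b} \<in> E \<longleftrightarrow> a \<in> A \<and> b \<in> {u, w1} \<or> a \<in> B \<and> b \<in> {u, w2}
            \<or> b \<in> A \<and> a \<in> {u, w1} \<or> b \<in> B \<and> a \<in> {u, w2} \<or> {a, b} = {w1, w2}" for a b
            by (rule adj)
        qed (use \<open>card B = 1\<close> fin N disj m in auto)
      next
        assume "card A = 1"
        show ?thesis
        proof (rule iso[of A B w2 w1])
          show "{a, b} \<in> E \<longleftrightarrow> a \<in> B \<and> b \<in> {u, w2} \<or> a \<in> A \<and> b \<in> {u, w1}
            \<or> b \<in> B \<and> a \<in> {u, w2} \<or> b \<in> A \<and> a \<in> {u, w1} \<or> {a, b} = {w2, w1}" for a b
            unfolding adj doubleton_eq_iff by blast
        qed (use \<open>card A = 1\<close> fin N disj m in auto)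
      qed
    qed
    then show ?thesis using cubic(1) by blast
  qed
  then show "cubic (card E) l \<le> 0" "cubic (card E) l = 0 \<Longrightarrow> ?iso" by auto
qed

end

section \<open>Both bounds for the spectral radius and their equality cases\<close>

theorem theorem1p1:
  fixes V :: "'a set" and E :: "'a set set"
  assumes "simple_graph V E" and "minimally_2_connected V E"
  shows "(even (card E) \<longrightarrow>
            spectral_radius V E \<le> sqrt (real (card E)) \<and>
            (spectral_radius V E = sqrt (real (card E)) \<longleftrightarrow>
               graph_iso V E (K2_V (card E div 2)) (K2_E (card E div 2))))
       \<and> (odd (card E) \<and> card E \<ge> 9 \<longrightarrow>
            spectral_radius V E \<le> rho1_star (card E) \<and>
            (spectral_radius V E = rho1_star (card E) \<longleftrightarrow>
               graph_iso V E (SK2_V ((card E - 1) div 2)) (SK2_E ((card E - 1) div 2))))"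
proof -
  define m where "m = card E"
  interpret minimally_2_connected_graph V E using assms by unfold_locales
  let ?\<rho> = "spectral_radius V E"
  have "V \<noteq> {}" using card_V by auto
  then have \<rho>_mem: "?\<rho> \<in> adj_eigenvalues V E"
    unfolding spectral_radius_def
    using finite_adj_eigenvalues adj_eigenvalues_nonempty finite_V by (intro Max_in) auto
  have le_\<rho>: "l \<le> ?\<rho>" if "l \<in> adj_eigenvalues V E" for l
    unfolding spectral_radius_def using finite_adj_eigenvalues[OF finite_V] that by (rule Max_ge)
  have even_case: "?\<rho> \<le> sqrt m \<and> (?\<rho> = sqrt m \<longleftrightarrow> graph_iso V E (K2_V (m div 2)) (K2_E (m div 2)))"
    if "even m"
  proof -
    have "card E \<noteq> 3" using that m_def by auto
    then interpret triangle_free_minimally_2_connected_graph V E by unfold_locales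
    note bound = adj_eigenvalue_square_le[OF \<rho>_mem, folded m_def]
    have le: "?\<rho> \<le> sqrt m" using bound(1) by (rule real_le_rsqrt)
    have "sqrt m \<le> ?\<rho>" if iso: "graph_iso V E (K2_V (m div 2)) (K2_E (m div 2))"
    proof -
      \<comment> \<open>Counting vertices yields the positivity of \<open>m div 2\<close> that the
        explicit eigenvector requires.\<close>
      obtain f where "bij_betw f V (K2_V (m div 2))" using iso by (auto simp: graph_iso_def)
      then have "card V = m div 2 + 2" by (simp add: bij_betw_same_card K2_V_def)
      then have "m div 2 > 0" using card_V by simp
      then have "sqrt (real (2 * (m div 2))) \<in> adj_eigenvalues V E"
        using sqrt_mem_adj_eigenvalues_K2 adj_eigenvalues_graph_iso[OF iso] by blast
      then show ?thesis using le_\<rho> \<open>even m\<close> by simp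
    qed
    moreover have "?\<rho>\<^sup>2 = m" if "?\<rho> = sqrt m" unfolding that by simp
    ultimately show ?thesis using le bound(2) by fastforce
  qed
  have odd_case: "?\<rho> \<le> rho1_star m
      \<and> (?\<rho> = rho1_star m \<longleftrightarrow> graph_iso V E (SK2_V ((m - 1) div 2)) (SK2_E ((m - 1) div 2)))"
    if m: "odd m" "m \<ge> 9"
  proof -
    have "card E \<noteq> 3" using m m_def by auto
    then interpret triangle_free_minimally_2_connected_graph V E by unfold_locales
    have star: "cubic m (rho1_star m) = 0" "rho1_star m > 1"
      using cubic_rho1_star rho1_star_gt_1 m by auto
    note bound = adj_eigenvalue_cubic_le[OF \<rho>_mem, folded m_def, OF _ m]
    \<comment> \<open>The sign condition is available only for eigenvalues above 1; smaller ones lie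
      below \<open>rho1_star m > 1\<close> anyway.\<close>
    have le: "?\<rho> \<le> rho1_star m"
      using bound(1) le_rho1_star star(2) by (cases "?\<rho> > 1") auto
    have "rho1_star m \<le> ?\<rho>" if iso: "graph_iso V E (SK2_V ((m - 1) div 2)) (SK2_E ((m - 1) div 2))"
    proof -
      have "2 * ((m - 1) div 2) + 1 = m" "(m - 1) div 2 > 0" using m by auto
      then have "rho1_star m \<in> adj_eigenvalues V E"
        using cubic_root_mem_adj_eigenvalues_SK2[of "(m - 1) div 2" "rho1_star m"] star
          adj_eigenvalues_graph_iso[OF iso] by auto
      then show ?thesis by (rule le_\<rho>)
    qed
    then show ?thesis using le bound(2) star by fastforce
  qed
  show ?thesis using even_case odd_case unfolding m_def by blast
qed

end
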